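(* Let $X$ be a reflexive complex Banach space and let $P_1,\dots,P_N\in\mathcal{B}(X)$ be type-U projections on $X$. For $1\le k,\ell\le N$ let $$T_{k\ell}=P_kP_\ell+(I-P_k)(I-P_\ell),$$ and suppose that $T\in\mathcal{B}(X)$ is a convex combination of products of the operators $T_{k\ell}$, $1\le k,\ell\le N$. Let $Z$ denote the closure of $\operatorname{Ran}(I-T)$. Then $X=\operatorname{Fix}T\oplus Z$, the projection $P_T$ onto $\operatorname{Fix}T$ along $Z$ is an orthoprojection, and for all $x\in X$ we have $$\|T^nx-P_Tx\|\to0,\quad n\to\infty.\qquad( * )$$ Moreover: (i) if $\operatorname{Ran}(I-T)$ is closed, then there exist $C>0$ and $r\in[0,1)$ such that $\|T^n-P_T\|\le Cr^n$ for all $n\ge0$; (ii) if $\operatorname{Ran}(I-T)$ is not closed, then the convergence in $( * )$ is arbitrarily slow and weakly arbitrarily slow; (iii) in either case there exists a dense subspace $X_0$ of $X$ such that for all $x\in X_0$ the convergence in $( * )$ is superpolynomially fast.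
   Context: $\mathcal{B}(X)$ is the algebra of bounded linear operators on $X$; $\operatorname{Ran}$ denotes range and $\operatorname{Fix}T=\operatorname{Ker}(I-T)$. A *projection* is $P\in\mathcal{B}(X)$ with $P^2=P$; it is an *orthoprojection* if $\|P\|\le1$. A projection $P\in\mathcal{B}(X)$ is a *type-U projection* if $P\ne0$ and $\|P-\frac12I\|\le\frac12$. Let $T_n\in\mathcal{B}(X)$, $n\ge0$, satisfy $\|T_nx\|\to0$ as $n\to\infty$ for all $x\in X$. The convergence is *arbitrarily slow* if for every sequence $(r_n)_{n\ge0}$ of non-negative scalars with $r_n\to0$ there exists $x\in X$ such that $\|T_nx\|\ge r_n$ for all $n\ge0$. It is *weakly arbitrarily slow* if for every such sequence $(r_n)_{n\ge0}$ there exist $x\in X$ and $\phi\in X^*$ such that $\operatorname{Re}\langle T_nx,\phi\rangle\ge r_n$ for all $n\ge0$, where $\langle x,\phi\rangle=\phi(x)$. It is *superpolynomially fast* for a particular $x\in X$ if $\|T_nx\|=o(n^{-k})$ as $n\to\infty$ for all $k\ge1$. For the convergence in $( * )$ these notions are applied with $T_n=T^n-P_T$. *)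

theory Defs
  imports "HOL-Analysis.Analysis" "HOL-Library.Landau_Symbols"
begin

section \<open>Complex Banach spaces\<close>

text \<open>
  The complex scalar multiplication extends the real one, so that a complex Banach space is also
  a \<^class>\<open>banach\<close> space and the library's operator norm and convex hulls apply to it.
\<close>

class scaleC = scaleR +
  fixes scaleC :: "complex \<Rightarrow> 'a \<Rightarrow> 'a"  (infixr \<open>*\<^sub>C\<close> 75)
  assumes scaleR_scaleC: "r *\<^sub>R x = complex_of_real r *\<^sub>C x"

class complex_vector = scaleC + real_vector +
  assumes scaleC_add_right: "a *\<^sub>C (x + y) = a *\<^sub>C x + a *\<^sub>C y"
    and scaleC_add_left: "(a + b) *\<^sub>C x = a *\<^sub>C x + b *\<^sub>C x"
    and scaleC_scaleC: "a *\<^sub>C b *\<^sub>C x = (a * b) *\<^sub>C x"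
    and scaleC_one: "1 *\<^sub>C x = x"

class complex_normed_vector = complex_vector + real_normed_vector +
  assumes norm_scaleC: "norm (a *\<^sub>C x) = cmod a * norm x"

class cbanach = complex_normed_vector + banach

lemma vector_space_scaleC: "vector_space (scaleC :: complex \<Rightarrow> 'a \<Rightarrow> 'a::complex_vector)"
  by unfold_locales (simp_all add: scaleC_add_right scaleC_add_left scaleC_scaleC scaleC_one)

instantiation complex :: cbanach
begin

definition scaleC_complex :: "complex \<Rightarrow> complex \<Rightarrow> complex"
  where "scaleC_complex = (*)"

instance
  by standard (simp_all add: scaleC_complex_def algebra_simps norm_mult scaleR_conv_of_real)

end

abbreviation csubspace :: "'a::complex_vector set \<Rightarrow> bool"
  where "csubspace \<equiv> module.subspace scaleC"

abbreviation clinear :: "('a::complex_vector \<Rightarrow> 'b::complex_vector) \<Rightarrow> bool"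
  where "clinear \<equiv> Vector_Spaces.linear scaleC scaleC"


section \<open>Bounded operators, the dual space and reflexivity\<close>

text \<open>
  The type of bounded linear functions consists of the real-linear ones; the complex-linear ones
  among them are singled out here. The operator norm is the same over both fields.
\<close>

definition cbounded_ops :: "('a::complex_normed_vector \<Rightarrow>\<^sub>L 'b::complex_normed_vector) set"
  where "cbounded_ops = {f. clinear (blinfun_apply f)}"

abbreviation cdual :: "('a::complex_normed_vector \<Rightarrow>\<^sub>L complex) set"
  where "cdual \<equiv> cbounded_ops"

instantiation blinfun :: (real_normed_vector, complex_normed_vector) complex_normed_vector
begin

lift_definition scaleC_blinfun :: "complex \<Rightarrow> ('a \<Rightarrow>\<^sub>L 'b) \<Rightarrow> 'a \<Rightarrow>\<^sub>L 'b"
  is "\<lambda>c f x. c *\<^sub>C f x"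
proof -
  fix c :: complex and f :: "'a \<Rightarrow> 'b"
  assume f: "bounded_linear f"
  interpret f: bounded_linear f by fact
  show "bounded_linear (\<lambda>x. c *\<^sub>C f x)"
  proof (rule bounded_linear_intro[where K = "cmod c * onorm f"])
    show "c *\<^sub>C f (x + y) = c *\<^sub>C f x + c *\<^sub>C f y" for x y
      by (simp add: f.add scaleC_add_right)
    show "c *\<^sub>C f (r *\<^sub>R x) = r *\<^sub>R c *\<^sub>C f x" for r x
      by (simp add: f.scaleR scaleR_scaleC scaleC_scaleC mult.commute)
    show "norm (c *\<^sub>C f x) \<le> norm x * (cmod c * onorm f)" for x
      using mult_left_mono[OF onorm[OF f, of x], of "cmod c"]
      by (simp add: norm_scaleC mult_ac)
  qed
qed

instance
proof
  fix a b :: complex and f g :: "'a \<Rightarrow>\<^sub>L 'b" and r :: real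
  show "r *\<^sub>R f = complex_of_real r *\<^sub>C f"
    by transfer (simp add: scaleR_scaleC)
  show "a *\<^sub>C (f + g) = a *\<^sub>C f + a *\<^sub>C g"
    by transfer (simp add: scaleC_add_right)
  show "(a + b) *\<^sub>C f = a *\<^sub>C f + b *\<^sub>C f"
    by transfer (simp add: scaleC_add_left)
  show "a *\<^sub>C b *\<^sub>C f = (a * b) *\<^sub>C f"
    by transfer (simp add: scaleC_scaleC)
  show "1 *\<^sub>C f = f"
    by transfer (simp add: scaleC_one)
  have le: "norm (c *\<^sub>C h) \<le> cmod c * norm h" for c and h :: "'a \<Rightarrow>\<^sub>L 'b"
  proof (rule norm_blinfun_bound)
    show "norm (blinfun_apply (c *\<^sub>C h) x) \<le> cmod c * norm h * norm x" for x
      using mult_left_mono[OF norm_blinfun[of h x], of "cmod c"]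
      by (simp add: scaleC_blinfun.rep_eq norm_scaleC mult_ac)
  qed simp
  show "norm (a *\<^sub>C f) = cmod a * norm f"
  proof (cases "a = 0")
    case True
    with le[of 0 f] show ?thesis by simp
  next
    case False
    have "inverse a *\<^sub>C a *\<^sub>C f = f"
      using False by transfer (simp add: scaleC_scaleC scaleC_one)
    with le[of "inverse a" "a *\<^sub>C f"] have "norm f \<le> norm (a *\<^sub>C f) / cmod a"
      by (simp add: norm_inverse divide_inverse mult.commute)
    with False have "cmod a * norm f \<le> norm (a *\<^sub>C f)"
      by (simp add: field_simps)
    with le[of a f] show ?thesis by simp
  qed
qed

end

text \<open>
  Since the dual is a set of bounded linear functions, elements of the bidual are functions that
  are linear and bounded on this set, with values elsewhere irrelevant.
\<close>

definition cbidual :: "(('a::complex_normed_vector \<Rightarrow>\<^sub>L complex) \<Rightarrow> complex) set"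
  where "cbidual = {\<Psi>.
     (\<forall>\<phi>\<in>cdual. \<forall>\<psi>\<in>cdual. \<Psi> (\<phi> + \<psi>) = \<Psi> \<phi> + \<Psi> \<psi>) \<and>
     (\<forall>c. \<forall>\<phi>\<in>cdual. \<Psi> (c *\<^sub>C \<phi>) = c * \<Psi> \<phi>) \<and>
     (\<exists>K. \<forall>\<phi>\<in>cdual. cmod (\<Psi> \<phi>) \<le> K * norm \<phi>)}"

definition reflexive_space :: "'a::complex_normed_vector itself \<Rightarrow> bool"
  where "reflexive_space _ \<longleftrightarrow>
     (\<forall>\<Psi> \<in> cbidual. \<exists>x::'a. \<forall>\<phi>\<in>cdual. \<Psi> \<phi> = blinfun_apply \<phi> x)"

definition op_ran :: "('a::real_normed_vector \<Rightarrow>\<^sub>L 'b::real_normed_vector) \<Rightarrow> 'b set"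
  where "op_ran T = range (blinfun_apply T)"

definition op_ker :: "('a::real_normed_vector \<Rightarrow>\<^sub>L 'b::real_normed_vector) \<Rightarrow> 'a set"
  where "op_ker T = {x. blinfun_apply T x = 0}"

definition op_fix :: "('a::real_normed_vector \<Rightarrow>\<^sub>L 'a) \<Rightarrow> 'a set"
  where "op_fix T = op_ker (id_blinfun - T)"

definition op_power :: "('a::real_normed_vector \<Rightarrow>\<^sub>L 'a) \<Rightarrow> nat \<Rightarrow> 'a \<Rightarrow>\<^sub>L 'a"
  where "op_power T n = ((\<lambda>S. T o\<^sub>L S) ^^ n) id_blinfun"

inductive_set op_products :: "('a::real_normed_vector \<Rightarrow>\<^sub>L 'a) set \<Rightarrow> ('a \<Rightarrow>\<^sub>L 'a) set"
  for A :: "('a \<Rightarrow>\<^sub>L 'a) set" where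
  single: "S \<in> A \<Longrightarrow> S \<in> op_products A"
| compose: "S \<in> A \<Longrightarrow> R \<in> op_products A \<Longrightarrow> S o\<^sub>L R \<in> op_products A"


section \<open>Projections\<close>

definition is_projection :: "('a::complex_normed_vector \<Rightarrow>\<^sub>L 'a) \<Rightarrow> bool"
  where "is_projection P \<longleftrightarrow> P \<in> cbounded_ops \<and> P o\<^sub>L P = P"

definition orthoprojection :: "('a::complex_normed_vector \<Rightarrow>\<^sub>L 'a) \<Rightarrow> bool"
  where "orthoprojection P \<longleftrightarrow> is_projection P \<and> norm P \<le> 1"

definition type_U_projection :: "('a::complex_normed_vector \<Rightarrow>\<^sub>L 'a) \<Rightarrow> bool"
  where "type_U_projection P \<longleftrightarrow>
     is_projection P \<and> P \<noteq> 0 \<and> norm (P - (1/2) *\<^sub>R id_blinfun) \<le> 1/2"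

definition projection_onto_along ::
    "('a::complex_normed_vector \<Rightarrow>\<^sub>L 'a) \<Rightarrow> 'a set \<Rightarrow> 'a set \<Rightarrow> bool"
  where "projection_onto_along P M Z \<longleftrightarrow> is_projection P \<and> op_ran P = M \<and> op_ker P = Z"

definition is_direct_sum :: "'a::complex_vector set \<Rightarrow> 'a set \<Rightarrow> bool"
  where "is_direct_sum M Z \<longleftrightarrow>
     csubspace M \<and> csubspace Z \<and> M \<inter> Z = {0} \<and> {y + z |y z. y \<in> M \<and> z \<in> Z} = UNIV"

definition T_pair :: "('i \<Rightarrow> 'a::real_normed_vector \<Rightarrow>\<^sub>L 'a) \<Rightarrow> 'i \<Rightarrow> 'i \<Rightarrow> 'a \<Rightarrow>\<^sub>L 'a"
  where "T_pair P k l = (P k o\<^sub>L P l) + ((id_blinfun - P k) o\<^sub>L (id_blinfun - P l))"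


section \<open>Rates of convergence\<close>

text \<open>
  These predicates concern a sequence of operators that converges strongly to zero; this
  convergence is not part of the definitions.
\<close>

definition arbitrarily_slow ::
    "(nat \<Rightarrow> 'a::complex_normed_vector \<Rightarrow>\<^sub>L 'a) \<Rightarrow> bool"
  where "arbitrarily_slow S \<longleftrightarrow>
     (\<forall>r::nat \<Rightarrow> real. (\<forall>n. 0 \<le> r n) \<longrightarrow> r \<longlonglongrightarrow> 0 \<longrightarrow>
        (\<exists>x. \<forall>n. norm (blinfun_apply (S n) x) \<ge> r n))"

definition weakly_arbitrarily_slow ::
    "(nat \<Rightarrow> 'a::complex_normed_vector \<Rightarrow>\<^sub>L 'a) \<Rightarrow> bool"
  where "weakly_arbitrarily_slow S \<longleftrightarrow>
     (\<forall>r::nat \<Rightarrow> real. (\<forall>n. 0 \<le> r n) \<longrightarrow> r \<longlonglongrightarrow> 0 \<longrightarrow>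
        (\<exists>x. \<exists>\<phi>\<in>cdual. \<forall>n. Re (blinfun_apply \<phi> (blinfun_apply (S n) x)) \<ge> r n))"

definition superpolynomially_fast ::
    "(nat \<Rightarrow> 'a::complex_normed_vector \<Rightarrow>\<^sub>L 'a) \<Rightarrow> 'a \<Rightarrow> bool"
  where "superpolynomially_fast S x \<longleftrightarrow>
     (\<forall>k\<ge>1::nat. (\<lambda>n. norm (blinfun_apply (S n) x)) \<in> o(\<lambda>n. 1 / real n ^ k))"

end

theory Submission
  imports Defs
begin

text \<open>
  With \<open>U k = 2 P k - I\<close>, a contraction, \<open>T_pair P k l = (I + U k U l) / 2\<close>. Operators of the form
  \<open>a I + (1 - a) S\<close> with \<open>0 < a < 1\<close> and \<open>S\<close> a contraction are stable under products and convex
  combinations, so \<open>T\<close> is one of them, and expanding \<open>T\<^sup>n\<close> binomially gives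
  \<open>\<parallel>T\<^sup>n (I - T)\<parallel> = O(n\<^sup>-\<^sup>1\<^sup>/\<^sup>2)\<close>. Reflexivity turns this into the mean ergodic decomposition and strong
  convergence. Put \<open>A = I - T\<close> and let \<open>Z\<close> be the closure of its range. If \<open>A\<close> is bounded below on
  \<open>Z\<close>, then \<open>T\<^sup>n \<rightarrow> 0\<close> in norm on \<open>Z\<close>, hence exponentially fast. Otherwise there are approximate
  eigenvectors of \<open>T\<close> and of its adjoint for the eigenvalue 1, and geometrically weighted sums of
  them form slowly decaying weak orbits. Finally, \<open>\<parallel>T\<^sup>n A\<^sup>k\<parallel> = O(n\<^sup>-\<^sup>k\<^sup>/\<^sup>2)\<close>, and the intersection of
  the ranges of the powers of \<open>A\<close> is dense in \<open>Z\<close>.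
\<close>

text \<open>The averaged form is what supplies a rate. That \<open>op_power T n o\<^sub>L A\<close>
  tends to 0 is enough for the strong limit, but the argument for superpolynomial speed raises the
  bound to arbitrary powers, so it has to be a fixed negative power of n. Reflexivity turns
  functionals on the dual into points of the space, once for the orbits of \<open>T\<close> and once
  for the adjoint; both times the functional comes from the Hahn-Banach theorem.

  The obstacle in the slow case is a lower bound for all n at once, with real parts of either sign
  and no orthogonality. Vector and functional are therefore perturbed together, and each new pair is
  chosen so that its cross terms with everything built before are small at every time. A pair is
  uncontrolled only between the time up to which it is large and the time from which it has died
  out. These periods are consecutive for successive pairs, so at any time one bad pair has to be
  outweighed by all later ones.\<close>

section \<open>The Hahn--Banach theorem\<close>

text \<open>
  Asking only for subhomogeneity with strictly positive factors keeps the conditions easy to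
  verify; homogeneity and the value 0 at the origin follow.
\<close>

definition sublinear :: "('b::real_vector \<Rightarrow> real) \<Rightarrow> bool"
  where "sublinear p \<longleftrightarrow>
    (\<forall>x y. p (x + y) \<le> p x + p y) \<and> (\<forall>c>0. \<forall>x. p (c *\<^sub>R x) \<le> c * p x)"

lemma sublinearI:
  assumes "\<And>x y. p (x + y) \<le> p x + p y" "\<And>c x. c > 0 \<Longrightarrow> p (c *\<^sub>R x) \<le> c * p x"
  shows "sublinear p"
  using assms by (auto simp: sublinear_def)

context
  fixes p :: "'b::real_vector \<Rightarrow> real"
  assumes p: "sublinear p"
begin

lemma sublinear_add: "p (x + y) \<le> p x + p y"
  using p by (auto simp: sublinear_def)

lemma sublinear_scale_pos: "p (c *\<^sub>R x) = c * p x" if "c > 0"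
proof (rule antisym)
  have le: "p (a *\<^sub>R y) \<le> a * p y" if "a > 0" for a y
    using p that by (auto simp: sublinear_def)
  show "p (c *\<^sub>R x) \<le> c * p x"
    using le that .
  have "p x \<le> p (c *\<^sub>R x) / c"
    using le[of "1/c" "c *\<^sub>R x"] that by simp
  then show "c * p x \<le> p (c *\<^sub>R x)"
    using that by (simp add: field_simps)
qed

lemma sublinear_zero: "p 0 = 0"
  using sublinear_scale_pos[of 2 0] by simp

lemma sublinear_scale: "p (c *\<^sub>R x) = c * p x" if "c \<ge> 0"
  using that sublinear_scale_pos[of c x] sublinear_zero by (cases "c = 0") auto

lemma sublinear_minus: "- p (- x) \<le> p x"
  using sublinear_add[of x "-x"] sublinear_zero by simp

end

text \<open>This is the largest sublinear minorant of \<open>p\<close> whose value at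
  \<open>- a\<close> is at most \<open>- p a\<close>; a linear functional below it must agree with
  \<open>p\<close> at \<open>a\<close>.\<close>

definition sublinear_slope :: "('b::real_vector \<Rightarrow> real) \<Rightarrow> 'b \<Rightarrow> 'b \<Rightarrow> real"
  where "sublinear_slope p a x = (INF t\<in>{0..}. p (x + t *\<^sub>R a) - t * p a)"

context
  fixes p :: "'b::real_vector \<Rightarrow> real" and a :: 'b
  assumes p: "sublinear p"
begin

lemma sublinear_slope_bdd: "bdd_below ((\<lambda>t. p (x + t *\<^sub>R a) - t * p a) ` {0..})"
proof (rule bdd_belowI2)
  fix t :: real assume "t \<in> {0..}"
  then have "t * p a = p (t *\<^sub>R a)"
    by (simp add: sublinear_scale[OF p])
  also have "\<dots> \<le> p (x + t *\<^sub>R a) + p (- x)"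
    using sublinear_add[OF p, of "x + t *\<^sub>R a" "-x"] by simp
  finally show "- p (- x) \<le> p (x + t *\<^sub>R a) - t * p a"
    by simp
qed

lemma sublinear_slope_le: "sublinear_slope p a x \<le> p (x + t *\<^sub>R a) - t * p a" if "t \<ge> 0"
  unfolding sublinear_slope_def using that by (intro cINF_lower sublinear_slope_bdd) auto

lemma sublinear_slope_greatest:
  assumes "\<And>t. t \<ge> 0 \<Longrightarrow> m \<le> p (x + t *\<^sub>R a) - t * p a"
  shows "m \<le> sublinear_slope p a x"
  unfolding sublinear_slope_def using assms by (intro cINF_greatest) auto

lemma sublinear_slope_le_self: "sublinear_slope p a x \<le> p x"
  using sublinear_slope_le[of 0 x] by simp

text \<open>Parameters \<open>s\<close> for \<open>x\<close> and \<open>t\<close> for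
  \<open>y\<close> combine to \<open>s + t\<close> for the sum, and \<open>c * t\<close> serves the
  multiple by \<open>c\<close>; the infima are then taken one at a time.\<close>

lemma sublinear_sublinear_slope: "sublinear (sublinear_slope p a)"
proof (rule sublinearI)
  fix x y
  have "sublinear_slope p a (x + y) - (p (y + t *\<^sub>R a) - t * p a) \<le> p (x + s *\<^sub>R a) - s * p a"
    if "s \<ge> 0" "t \<ge> 0" for s t
    using sublinear_slope_le[of "s + t" "x + y"] that
      sublinear_add[OF p, of "x + s *\<^sub>R a" "y + t *\<^sub>R a"]
    by (simp add: algebra_simps)
  then have "sublinear_slope p a (x + y) - (p (y + t *\<^sub>R a) - t * p a) \<le> sublinear_slope p a x"
    if "t \<ge> 0" for t
    using that by (intro sublinear_slope_greatest) auto
  then have "sublinear_slope p a (x + y) - sublinear_slope p a x \<le> sublinear_slope p a y"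
    by (intro sublinear_slope_greatest) (simp add: algebra_simps)
  then show "sublinear_slope p a (x + y) \<le> sublinear_slope p a x + sublinear_slope p a y"
    by simp
next
  fix c :: real and x assume c: "c > 0"
  have "sublinear_slope p a (c *\<^sub>R x) / c \<le> p (x + t *\<^sub>R a) - t * p a" if "t \<ge> 0" for t
  proof -
    have "sublinear_slope p a (c *\<^sub>R x) \<le> p (c *\<^sub>R (x + t *\<^sub>R a)) - c * t * p a"
      using sublinear_slope_le[of "c * t" "c *\<^sub>R x"] c that by (simp add: algebra_simps)
    also have "\<dots> = c * (p (x + t *\<^sub>R a) - t * p a)"
      using c by (simp add: sublinear_scale_pos[OF p] right_diff_distrib del: scaleR_right_distrib scaleR_add_right)
    finally show ?thesis
      using c by (simp add: field_simps)
  qed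
  then have "sublinear_slope p a (c *\<^sub>R x) / c \<le> sublinear_slope p a x"
    by (rule sublinear_slope_greatest)
  then show "sublinear_slope p a (c *\<^sub>R x) \<le> c * sublinear_slope p a x"
    using c by (simp add: field_simps)
qed

end

text \<open>Supplies the bound for Zorn's lemma. Subadditivity uses the chain: values
  \<open>q x\<close> and \<open>r y\<close> of different members are both bounded below through the
  smaller one. The lower bound \<open>- p (- x)\<close> keeps the infimum finite.\<close>

lemma chain_INF_sublinear:
  fixes C :: "('b::real_vector \<Rightarrow> real) set"
  assumes "C \<noteq> {}" and sub: "\<And>q. q \<in> C \<Longrightarrow> sublinear q"
    and le: "\<And>q x. q \<in> C \<Longrightarrow> q x \<le> p x"
    and chain: "\<And>q r. q \<in> C \<Longrightarrow> r \<in> C \<Longrightarrow> q \<le> r \<or> r \<le> q"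
  defines "u \<equiv> \<lambda>x. INF q\<in>C. q x"
  shows "sublinear u" "\<And>q x. q \<in> C \<Longrightarrow> u x \<le> q x"
proof -
  have bdd: "bdd_below ((\<lambda>q. q x) ` C)" for x
  proof (rule bdd_belowI2)
    fix q assume "q \<in> C"
    then show "- p (- x) \<le> q x"
      using sublinear_minus[OF sub, of q x] le[of q "-x"] by simp
  qed
  show lower: "u x \<le> q x" if "q \<in> C" for q x
    unfolding u_def by (rule cINF_lower[OF bdd that])
  have greatest: "m \<le> u x" if "\<And>q. q \<in> C \<Longrightarrow> m \<le> q x" for m x
    unfolding u_def using \<open>C \<noteq> {}\<close> that by (rule cINF_greatest)
  show "sublinear u"
  proof (rule sublinearI)
    fix x y
    have "u (x + y) - r y \<le> q x" if "q \<in> C" "r \<in> C" for q r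
    proof -
      obtain s where "s \<in> C" "s \<le> q" "s \<le> r"
        using chain[of q r] \<open>q \<in> C\<close> \<open>r \<in> C\<close> by (meson order_refl)
      moreover from this have "u (x + y) \<le> s x + s y"
        using lower[of s "x + y"] sublinear_add[OF sub, of s x y] by simp
      ultimately show ?thesis
        by (simp add: le_fun_def) (smt (verit))
    qed
    then have "u (x + y) - r y \<le> u x" if "r \<in> C" for r
      using that by (intro greatest) auto
    then have "u (x + y) - u x \<le> u y"
      by (intro greatest) (simp add: algebra_simps)
    then show "u (x + y) \<le> u x + u y"
      by simp
  next
    fix c :: real and x assume c: "c > 0"
    have "u (c *\<^sub>R x) / c \<le> q x" if "q \<in> C" for q
      using lower[OF that, of "c *\<^sub>R x"] c by (simp add: sublinear_scale_pos[OF sub[OF that]] field_simps)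
    then have "u (c *\<^sub>R x) / c \<le> u x"
      by (rule greatest)
    then show "u (c *\<^sub>R x) \<le> c * u x"
      using c by (simp add: field_simps)
  qed
qed

text \<open>A minimal sublinear functional agrees with all its slopes, and is therefore linear.\<close>

lemma sublinear_dominates_linear:
  fixes p :: "'b::real_vector \<Rightarrow> real"
  assumes p: "sublinear p"
  obtains f where "linear f" "\<And>x. f x \<le> p x"
proof -
  define S where "S = {q. sublinear q \<and> q \<le> p}"
  \<comment> \<open>The order is reversed, so the maximal element of Zorn's lemma is a minimal
    functional.\<close>
  let ?R = "\<lambda>q r :: 'b \<Rightarrow> real. r \<le> q"
  have "\<exists>m\<in>S. \<forall>q\<in>S. q \<le> m \<longrightarrow> q = m"
  proof (rule predicate_Zorn[where P = ?R])
    show "partial_order_on S (relation_of ?R S)"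
      by (rule partial_order_on_relation_ofI) auto
    fix C assume C: "C \<in> Chains (relation_of ?R S)"
    then have CS: "C \<subseteq> S" and chain: "\<And>q r. q \<in> C \<Longrightarrow> r \<in> C \<Longrightarrow> q \<le> r \<or> r \<le> q"
      by (auto simp: Chains_def relation_of_def)
    show "\<exists>u\<in>S. \<forall>q\<in>C. u \<le> q"
    proof (cases "C = {}")
      case True
      then show ?thesis
        using p by (auto simp: S_def)
    next
      case False
      then obtain q where "q \<in> C" by blast
      let ?u = "\<lambda>x. INF q\<in>C. q x"
      have "sublinear ?u" and *: "\<And>q x. q \<in> C \<Longrightarrow> ?u x \<le> q x"
        using chain_INF_sublinear[of C p] False CS chain by (auto simp: S_def le_fun_def)
      moreover have "?u \<le> p"
        using *[OF \<open>q \<in> C\<close>] \<open>q \<in> C\<close> CS by (force simp: S_def le_fun_def intro: order_trans)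
      ultimately show ?thesis
        by (intro bexI[of _ ?u]) (auto simp: S_def le_fun_def)
    qed
  qed
  then obtain m where m: "sublinear m" "m \<le> p"
    and min: "\<And>q. sublinear q \<Longrightarrow> q \<le> m \<Longrightarrow> q = m"
    unfolding S_def by (smt (verit) mem_Collect_eq order_trans)
  have "sublinear_slope m a = m" for a
    using sublinear_sublinear_slope[OF m(1)] sublinear_slope_le_self[OF m(1)]
    by (intro min) (auto simp: le_fun_def)
  \<comment> \<open>The slope inequality with \<open>t = 1\<close> is the converse of
    subadditivity.\<close>
  then have add: "m (x + y) = m x + m y" for x y
    using sublinear_slope_le[OF m(1), of 1 y x] sublinear_add[OF m(1), of x y] by simp
  have neg: "m (- x) = - m x" for x
    using add[of x "-x"] sublinear_zero[OF m(1)] by simp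
  have "linear m"
  proof (rule linearI)
    show "m (c *\<^sub>R x) = c *\<^sub>R m x" for c x
      using sublinear_scale[OF m(1), of c x] sublinear_scale[OF m(1), of "-c" "-x"] neg[of x]
      by (cases "c \<ge> 0") auto
  qed (rule add)
  then show thesis
    using that m(2) by (auto simp: le_fun_def)
qed

text \<open>A linear functional below the slope at \<open>a\<close> is at most \<open>- p a\<close>
  at \<open>- a\<close>, hence at least \<open>p a\<close> at \<open>a\<close>. Tightness at one
  point plays the part of extending from the line through \<open>a\<close>.\<close>

theorem Hahn_Banach_sublinear:
  fixes p :: "'b::real_vector \<Rightarrow> real"
  assumes p: "sublinear p"
  obtains f where "linear f" "\<And>x. f x \<le> p x" "f a = p a"
proof -
  obtain f where f: "linear f" "\<And>x. f x \<le> sublinear_slope p a x"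
    using sublinear_dominates_linear[OF sublinear_sublinear_slope[OF p]] by metis
  have le: "f x \<le> p x" for x
    using f(2) sublinear_slope_le_self[OF p] by (rule order_trans)
  have "f (- a) \<le> - p a"
    using f(2)[of "-a"] sublinear_slope_le[OF p, where t = 1 and x = "-a" and a = a] by (simp add: sublinear_zero[OF p])
  then have "f a \<ge> p a"
    by (simp add: linear_neg[OF f(1)])
  then show thesis
    using that[OF f(1)] le[of a] le by (simp add: antisym)
qed

section \<open>Complex functionals\<close>

interpretation complex_vector: vector_space "scaleC :: complex \<Rightarrow> 'a \<Rightarrow> 'a::complex_vector"
  by (rule vector_space_scaleC)

lemma csubspaceI:
  assumes "0 \<in> S" "\<And>x y. x \<in> S \<Longrightarrow> y \<in> S \<Longrightarrow> x + y \<in> S" "\<And>c x. x \<in> S \<Longrightarrow> c *\<^sub>C x \<in> S"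
  shows "csubspace S"
  using assms by (auto simp: complex_vector.subspace_def)

lemma csubspace_subspace: "csubspace S \<Longrightarrow> subspace S"
  by (auto simp: complex_vector.subspace_def subspace_def scaleR_scaleC)

lemma clinear_iff:
  "clinear f \<longleftrightarrow> (\<forall>x y. f (x + y) = f x + f y) \<and> (\<forall>c x. f (c *\<^sub>C x) = c *\<^sub>C f x)"
  by (auto simp: Vector_Spaces.linear_iff vector_space_scaleC)

lemma cbounded_ops_iff: "f \<in> cbounded_ops \<longleftrightarrow> (\<forall>c x. blinfun_apply f (c *\<^sub>C x) = c *\<^sub>C blinfun_apply f x)"
  by (auto simp: cbounded_ops_def clinear_iff blinfun.add_right)

lemma bounded_linear_scaleC: "bounded_linear (\<lambda>x::'a::complex_normed_vector. c *\<^sub>C x)"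
  by (rule bounded_linear_intro[where K = "cmod c"])
     (simp_all add: scaleC_add_right scaleR_scaleC scaleC_scaleC norm_scaleC mult.commute)

lemmas tendsto_scaleC [tendsto_intros] = bounded_linear.tendsto[OF bounded_linear_scaleC]

lemma scaleC_zero_right [simp]: "c *\<^sub>C (0::'a::complex_vector) = 0"
  by (rule complex_vector.scale_zero_right)

lemma scaleC_diff_right: "c *\<^sub>C (x - y) = c *\<^sub>C x - c *\<^sub>C (y::'a::complex_vector)"
  by (rule complex_vector.scale_right_diff_distrib)

lemma cbounded_ops_zero [simp]: "0 \<in> cbounded_ops"
  and cbounded_ops_id [simp]: "id_blinfun \<in> cbounded_ops"
  by (auto simp: cbounded_ops_iff)

lemma cbounded_ops_add: "f \<in> cbounded_ops \<Longrightarrow> g \<in> cbounded_ops \<Longrightarrow> f + g \<in> cbounded_ops"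
  and cbounded_ops_diff: "f \<in> cbounded_ops \<Longrightarrow> g \<in> cbounded_ops \<Longrightarrow> f - g \<in> cbounded_ops"
  by (auto simp: cbounded_ops_iff blinfun.add_left blinfun.diff_left scaleC_add_right scaleC_diff_right)

lemma cbounded_ops_scaleC: "f \<in> cbounded_ops \<Longrightarrow> a *\<^sub>C f \<in> cbounded_ops"
  by (auto simp: cbounded_ops_iff scaleC_blinfun.rep_eq scaleC_scaleC mult.commute)

lemma cbounded_ops_scaleR: "f \<in> cbounded_ops \<Longrightarrow> a *\<^sub>R f \<in> cbounded_ops"
  by (simp add: scaleR_scaleC cbounded_ops_scaleC)

lemma cbounded_ops_compose:
  "f \<in> cbounded_ops \<Longrightarrow> g \<in> cbounded_ops \<Longrightarrow> f o\<^sub>L g \<in> cbounded_ops"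
  by (auto simp: cbounded_ops_iff)

lemma csubspace_cbounded_ops: "csubspace cbounded_ops"
  by (intro csubspaceI cbounded_ops_zero cbounded_ops_add cbounded_ops_scaleC)

lemma cbounded_ops_limit:
  assumes "\<And>n. f n \<in> cbounded_ops" "f \<longlonglongrightarrow> g"
  shows "g \<in> cbounded_ops"
  unfolding cbounded_ops_iff
proof (intro allI)
  fix c x
  have lim: "(\<lambda>n. blinfun_apply (f n) y) \<longlonglongrightarrow> blinfun_apply g y" for y
    using assms(2) by (intro tendsto_intros)
  have "(\<lambda>n. c *\<^sub>C blinfun_apply (f n) x) \<longlonglongrightarrow> c *\<^sub>C blinfun_apply g x"
    by (intro tendsto_intros lim)
  moreover have "(\<lambda>n. c *\<^sub>C blinfun_apply (f n) x) = (\<lambda>n. blinfun_apply (f n) (c *\<^sub>C x))"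
    using assms(1) by (simp add: cbounded_ops_iff)
  ultimately show "blinfun_apply g (c *\<^sub>C x) = c *\<^sub>C blinfun_apply g x"
    using LIMSEQ_unique[OF lim[of "c *\<^sub>C x"]] by simp
qed

lemma csubspace_op_ker: "f \<in> cbounded_ops \<Longrightarrow> csubspace (op_ker f)"
  by (intro csubspaceI) (auto simp: op_ker_def blinfun.add_right cbounded_ops_iff)

lemma csubspace_op_ran: "f \<in> cbounded_ops \<Longrightarrow> csubspace (op_ran f)"
  by (intro csubspaceI)
     (auto simp: op_ran_def cbounded_ops_iff image_iff
       intro: exI[of _ 0] blinfun.add_right[symmetric] sym)

lemma csubspace_closure:
  fixes S :: "'a::complex_normed_vector set"
  assumes "csubspace S"
  shows "csubspace (closure S)"
proof (rule csubspaceI)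
  show "0 \<in> closure S"
    using assms closure_subset by (auto simp: complex_vector.subspace_def)
next
  fix x y assume "x \<in> closure S" "y \<in> closure S"
  then obtain a b where "\<And>n. a n \<in> S" "a \<longlonglongrightarrow> x" "\<And>n. b n \<in> S" "b \<longlonglongrightarrow> y"
    by (auto simp: closure_sequential)
  then show "x + y \<in> closure S"
    using assms unfolding closure_sequential
    by (intro exI[of _ "\<lambda>n. a n + b n"]) (auto simp: complex_vector.subspace_def intro: tendsto_add)
next
  fix c x assume "x \<in> closure S"
  then obtain a where "\<And>n. a n \<in> S" "a \<longlonglongrightarrow> x"
    by (auto simp: closure_sequential)
  then show "c *\<^sub>C x \<in> closure S"
    using assms unfolding closure_sequential
    by (intro exI[of _ "\<lambda>n. c *\<^sub>C a n"]) (auto simp: complex_vector.subspace_def intro: tendsto_scaleC)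
qed

section \<open>Functionals separating a point from a subspace\<close>

lemma sublinear_infdist:
  fixes M :: "'b::real_normed_vector set"
  assumes M: "subspace M"
  shows "sublinear (\<lambda>x. infdist x M)"
proof -
  have ne: "M \<noteq> {}"
    using subspace_0[OF M] by auto
  have greatest: "d \<le> infdist x M" if "\<And>m. m \<in> M \<Longrightarrow> d \<le> dist x m" for d x
    using that ne by (auto simp: infdist_notempty intro: cINF_greatest)
  show ?thesis
  proof (rule sublinearI)
    fix x y
    have "infdist (x + y) M - dist y n \<le> dist x m" if "m \<in> M" "n \<in> M" for m n
      using infdist_le[OF subspace_add[OF M that], of "x + y"] dist_triangle_add[of x y m n] by simp
    then have "infdist (x + y) M - dist y n \<le> infdist x M" if "n \<in> M" for n
      using that by (intro greatest)
    then have "infdist (x + y) M - infdist x M \<le> infdist y M"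
      by (intro greatest) (simp add: algebra_simps)
    then show "infdist (x + y) M \<le> infdist x M + infdist y M"
      by simp
  next
    fix c :: real and x assume c: "c > 0"
    have "infdist (c *\<^sub>R x) M / c \<le> dist x m" if "m \<in> M" for m
      using infdist_le[OF subspace_scale[OF M that, of c], of "c *\<^sub>R x"] c
      by (simp add: dist_norm flip: scaleR_diff_right) (simp add: field_simps)
    then have "infdist (c *\<^sub>R x) M / c \<le> infdist x M"
      by (rule greatest)
    then show "infdist (c *\<^sub>R x) M \<le> c * infdist x M"
      using c by (simp add: field_simps)
  qed
qed

text \<open>Domination by the distance yields everything together: the distance is at most the norm,
  it vanishes on the symmetric set \<open>M\<close>, and tightness gives the value at
  \<open>a\<close>.\<close>

lemma Hahn_Banach_infdist:
  fixes M :: "'b::real_normed_vector set"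
  assumes M: "subspace M"
  obtains f where "linear f" "\<And>x. \<bar>f x\<bar> \<le> norm x" "\<And>m. m \<in> M \<Longrightarrow> f m = 0" "f a = infdist a M"
proof -
  obtain f where f: "linear f" "\<And>x. f x \<le> infdist x M" "f a = infdist a M"
    using Hahn_Banach_sublinear[OF sublinear_infdist[OF M]] by metis
  have norm: "f x \<le> norm x" for x
    using f(2)[of x] infdist_le[OF subspace_0[OF M], of x] by simp
  have "\<bar>f x\<bar> \<le> norm x" for x
    using norm[of x] norm[of "-x"] by (simp add: linear_neg[OF f(1)])
  moreover have "f m = 0" if "m \<in> M" for m
    using f(2)[of m] f(2)[of "-m"] that subspace_neg[OF M that] by (simp add: linear_neg[OF f(1)])
  ultimately show thesis
    using that f by blast
qed

text \<open>For real-linear \<open>f\<close> this is the unique complex-linear functional with real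
  part \<open>f\<close>.\<close>

definition complexify :: "('b::complex_vector \<Rightarrow> real) \<Rightarrow> 'b \<Rightarrow> complex"
  where "complexify f x = Complex (f x) (- f (\<i> *\<^sub>C x))"

lemma Re_complexify [simp]: "Re (complexify f x) = f x"
  by (simp add: complexify_def)

lemma complexify_add:
  assumes "linear f" shows "complexify f (x + y) = complexify f x + complexify f y"
  by (simp add: complexify_def complex_eq_iff linear_add[OF assms] scaleC_add_right)

lemma complexify_scaleC:
  assumes "linear f" shows "complexify f (c *\<^sub>C x) = c * complexify f x"
proof -
  have *: "f (a *\<^sub>C y) = Re a * f y + Im a * f (\<i> *\<^sub>C y)" for a y
  proof -
    have "a *\<^sub>C y = Re a *\<^sub>R y + Im a *\<^sub>R \<i> *\<^sub>C y"
      by (simp add: scaleR_scaleC scaleC_scaleC flip: scaleC_add_left)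
         (simp add: complex_eq mult.commute)
    then show ?thesis
      by (simp add: linear_add[OF assms] linear_scale[OF assms])
  qed
  show ?thesis
    using *[of c x] *[of "\<i> * c" x]
    by (simp add: complexify_def complex_eq_iff scaleC_scaleC)
qed

text \<open>Adding the moduli of real and imaginary part costs a factor 2, the source of the bound
  \<open>norm \<phi> \<le> 2\<close> for the functionals used later.\<close>

lemma norm_complexify_le:
  fixes f :: "'b::complex_normed_vector \<Rightarrow> real"
  assumes "\<And>x. \<bar>f x\<bar> \<le> norm x"
  shows "cmod (complexify f x) \<le> 2 * norm x"
  using cmod_le[of "complexify f x"] assms[of x] assms[of "\<i> *\<^sub>C x"]
  by (simp add: complexify_def norm_scaleC)

lemma complex_Hahn_Banach_infdist:
  fixes M :: "'a::complex_normed_vector set"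
  assumes M: "csubspace M"
  obtains \<phi> where "\<phi> \<in> cdual" "norm \<phi> \<le> 2" "\<And>m. m \<in> M \<Longrightarrow> blinfun_apply \<phi> m = 0"
    "Re (blinfun_apply \<phi> a) = infdist a M"
proof -
  obtain f where f: "linear f" "\<And>x. \<bar>f x\<bar> \<le> norm x" "\<And>m. m \<in> M \<Longrightarrow> f m = 0" "f a = infdist a M"
    using Hahn_Banach_infdist[OF csubspace_subspace[OF M]] by metis
  have "bounded_linear (complexify f)"
    using norm_complexify_le[OF f(2)]
    by (intro bounded_linear_intro[where K = 2])
       (simp_all add: complexify_add[OF f(1)] complexify_scaleC[OF f(1)] scaleR_scaleC mult.commute
         scaleC_complex_def)
  then have app: "blinfun_apply (Blinfun (complexify f)) = complexify f"
    by (rule bounded_linear_Blinfun_apply)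
  show thesis
  proof
    show "Blinfun (complexify f) \<in> cdual"
      by (simp add: cbounded_ops_iff app complexify_scaleC[OF f(1)] scaleC_complex_def)
    show "norm (Blinfun (complexify f)) \<le> 2"
      using norm_complexify_le[OF f(2)] by (intro norm_blinfun_bound) (simp_all add: app)
    \<comment> \<open>As \<open>M\<close> is a complex subspace, \<open>f\<close> also vanishes at
      \<open>\<i> *\<^sub>C m\<close>, which removes the imaginary part.\<close>
    show "blinfun_apply (Blinfun (complexify f)) m = 0" if "m \<in> M" for m
      using that M by (simp add: app complexify_def f(3) complex_vector.subspace_def complex_eq_iff)
    show "Re (blinfun_apply (Blinfun (complexify f)) a) = infdist a M"
      by (simp add: app f(4))
  qed
qed

lemma mem_closed_csubspace_if_annihilated:
  fixes M :: "'a::complex_normed_vector set"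
  assumes M: "csubspace M" "closed M"
    and annihilated: "\<And>\<phi>. \<phi> \<in> cdual \<Longrightarrow> (\<And>m. m \<in> M \<Longrightarrow> blinfun_apply \<phi> m = 0) \<Longrightarrow> Re (blinfun_apply \<phi> x) = 0"
  shows "x \<in> M"
proof -
  have "infdist x M = 0"
    using complex_Hahn_Banach_infdist[OF M(1), of x] annihilated by metis
  moreover have "M \<noteq> {}"
    using M(1) by (auto simp: complex_vector.subspace_def)
  ultimately show ?thesis
    using M(2) by (simp add: in_closed_iff_infdist_zero)
qed

lemma eq_zero_if_annihilated:
  fixes x :: "'a::complex_normed_vector"
  assumes "\<And>\<phi>. \<phi> \<in> cdual \<Longrightarrow> Re (blinfun_apply \<phi> x) = 0"
  shows "x = 0"
  using mem_closed_csubspace_if_annihilated[of "{0}" x] assms by (simp add: csubspaceI)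

lemma norming_functional:
  fixes x :: "'a::complex_normed_vector"
  obtains \<phi> where "\<phi> \<in> cdual" "norm \<phi> \<le> 2" "Re (blinfun_apply \<phi> x) = norm x"
  using complex_Hahn_Banach_infdist[of "{0}" x] by (auto simp: csubspaceI)

text \<open>
  Reflexivity, phrased for real-linear functionals on all bounded real-linear maps: these restrict
  to the dual and are the real parts of elements of the bidual.
\<close>

lemma reflexive_represents:
  fixes f :: "('a::complex_normed_vector \<Rightarrow>\<^sub>L complex) \<Rightarrow> real"
  assumes refl: "reflexive_space TYPE('a)" and f: "linear f" "\<And>\<phi>. \<bar>f \<phi>\<bar> \<le> K * norm \<phi>"
  obtains y where "\<And>\<phi>. \<phi> \<in> cdual \<Longrightarrow> f \<phi> = Re (blinfun_apply \<phi> y)"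
proof -
  have "cmod (complexify f \<phi>) \<le> (2 * K) * norm \<phi>" for \<phi>
    using cmod_le[of "complexify f \<phi>"] f(2)[of \<phi>] f(2)[of "\<i> *\<^sub>C \<phi>"]
    by (simp add: complexify_def norm_scaleC)
  then have "complexify f \<in> cbidual"
    using f(1) by (auto simp: cbidual_def complexify_add complexify_scaleC)
  then obtain y where "\<And>\<phi>. \<phi> \<in> cdual \<Longrightarrow> complexify f \<phi> = blinfun_apply \<phi> y"
    using refl unfolding reflexive_space_def by blast
  then show thesis
    using that Re_complexify by metis
qed

section \<open>Powers of contractions\<close>

lemma op_power_0 [simp]: "op_power T 0 = id_blinfun"
  and op_power_Suc: "op_power T (Suc n) = T o\<^sub>L op_power T n"
  by (simp_all add: op_power_def)

lemma op_power_apply: "blinfun_apply (op_power T n) x = (blinfun_apply T ^^ n) x"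
  by (induction n) (simp_all add: op_power_Suc)

lemma op_power_add_apply:
  "blinfun_apply (op_power T (m + n)) x = blinfun_apply (op_power T m) (blinfun_apply (op_power T n) x)"
  by (simp add: op_power_apply funpow_add)

lemma op_power_commute:
  "blinfun_apply T (blinfun_apply (op_power T n) x) = blinfun_apply (op_power T n) (blinfun_apply T x)"
  by (simp add: op_power_apply funpow_swap1)

lemma norm_op_power_le_1: "norm T \<le> 1 \<Longrightarrow> norm (op_power T n) \<le> 1"
proof (induction n)
  case 0
  then show ?case
    using norm_blinfun_id_le by simp
next
  case (Suc n)
  have "norm (op_power T (Suc n)) \<le> norm T * norm (op_power T n)"
    by (simp add: op_power_Suc norm_blinfun_compose)
  also have "\<dots> \<le> 1"
    using Suc by (intro mult_le_one) auto
  finally show ?case .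
qed

lemma op_power_mem_cbounded_ops: "T \<in> cbounded_ops \<Longrightarrow> op_power T n \<in> cbounded_ops"
  by (induction n) (simp_all add: op_power_Suc cbounded_ops_compose)

section \<open>Binomial probabilities\<close>

lemma Bernstein_eq_0 [simp]: "n < k \<Longrightarrow> Bernstein n k p = 0"
  by (simp add: Bernstein_def)

lemma Bernstein_Suc_0: "Bernstein (Suc n) 0 p = (1 - p) * Bernstein n 0 p"
  by (simp add: Bernstein_def)

lemma Bernstein_Suc_Suc:
  "Bernstein (Suc n) (Suc k) p = (1 - p) * Bernstein n (Suc k) p + p * Bernstein n k p"
proof (cases "Suc k \<le> n")
  case True
  then have "n - k = Suc (n - Suc k)" by simp
  then show ?thesis
    by (simp add: Bernstein_def algebra_simps)
qed (simp add: Bernstein_def binomial_eq_0 algebra_simps)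

text \<open>With \<open>Bernstein_Suc_right\<close> this expresses two neighbouring probabilities of
  order n through the same one of order n + 1, so that their difference becomes a deviation from the
  mean.\<close>

lemma Bernstein_Suc_left: "real (Suc n) * (1 - p) * Bernstein n k p = (real (Suc n) - real k) * Bernstein (Suc n) k p"
proof (cases "k \<le> n")
  case True
  have "Suc n * (n choose k) = (Suc n - k) * (Suc n choose k)"
    using binomial_absorb_comp[of "Suc n" k] by simp
  then have "real (Suc n) * real (n choose k) = (real (Suc n) - real k) * real (Suc n choose k)"
    using True by (metis le_SucI of_nat_diff of_nat_mult)
  moreover have "(1 - p) ^ (Suc n - k) = (1 - p) * (1 - p) ^ (n - k)"
    using True by (simp add: Suc_diff_le)
  ultimately show ?thesis
    by (simp add: Bernstein_def)
next
  case False
  then show ?thesis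
    by (cases "k = Suc n") auto
qed

lemma Bernstein_Suc_right: "real (Suc n) * p * Bernstein n k p = real (Suc k) * Bernstein (Suc n) (Suc k) p"
proof -
  have "real (Suc k) * real (Suc n choose Suc k) = real (Suc n) * real (n choose k)"
    using Suc_times_binomial[of k n] by (metis of_nat_mult)
  then show ?thesis
    by (simp add: Bernstein_def)
qed

text \<open>The square is expanded in the factorial moments 1, k and k (k - 1), whose Bernstein sums
  are known.\<close>

lemma sum_Bernstein_variance: "(\<Sum>k\<le>n. (real k - real n * p)\<^sup>2 * Bernstein n k p) = real n * p * (1 - p)"
proof -
  have "(real k - real n * p)\<^sup>2 * Bernstein n k p
      = real k * (real k - 1) * Bernstein n k p + (1 - 2 * real n * p) * (real k * Bernstein n k p)
        + (real n * p)\<^sup>2 * Bernstein n k p" for k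
    by (simp add: power2_eq_square algebra_simps)
  then have "(\<Sum>k\<le>n. (real k - real n * p)\<^sup>2 * Bernstein n k p)
      = real n * (real n - 1) * p\<^sup>2 + (1 - 2 * real n * p) * (real n * p) + (real n * p)\<^sup>2"
    by (simp only: sum.distrib flip: sum_distrib_left) simp
  then show ?thesis
    by (simp add: power2_eq_square algebra_simps)
qed

text \<open>Cauchy-Schwarz through the pointwise bound \<bar>y\<bar> \<le> (y^2 / s + s) / 2, where
  s is the standard deviation; each of the two terms then contributes s / 2.\<close>

lemma sum_Bernstein_mean_deviation:
  assumes p: "0 < p" "p < 1"
  shows "(\<Sum>k\<le>Suc n. \<bar>real k - real (Suc n) * p\<bar> * Bernstein (Suc n) k p) \<le> sqrt (real (Suc n) * p * (1 - p))"
    (is "?S \<le> sqrt ?V")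
proof -
  have V: "?V > 0"
    using p by simp
  have "\<bar>y\<bar> \<le> (y\<^sup>2 / sqrt ?V + sqrt ?V) / 2" for y
  proof -
    have s: "sqrt ?V > 0"
      using V by simp
    then have "0 \<le> (\<bar>y\<bar> - sqrt ?V)\<^sup>2 / sqrt ?V"
      by simp
    also have "\<dots> = y\<^sup>2 / sqrt ?V + sqrt ?V - 2 * \<bar>y\<bar>"
      using s by (simp only: power2_diff power2_abs add_divide_distrib diff_divide_distrib) (use p V in \<open>simp add: real_div_sqrt\<close>)
    finally show ?thesis by simp
  qed
  then have "?S \<le> (\<Sum>k\<le>Suc n. ((real k - real (Suc n) * p)\<^sup>2 / sqrt ?V + sqrt ?V) / 2 * Bernstein (Suc n) k p)"
    using p by (intro sum_mono mult_right_mono Bernstein_nonneg) auto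
  also have "\<dots> = (\<Sum>k\<le>Suc n. (1 / (2 * sqrt ?V)) * ((real k - real (Suc n) * p)\<^sup>2 * Bernstein (Suc n) k p)
      + sqrt ?V / 2 * Bernstein (Suc n) k p)"
    by (intro sum.cong) (auto simp: field_simps simp del: of_nat_Suc)
  also have "\<dots> = (1 / (2 * sqrt ?V)) * ?V + sqrt ?V / 2"
    by (simp only: sum.distrib sum_Bernstein_variance sum_Bernstein mult_1_right flip: sum_distrib_left)
  also have "\<dots> = (?V / sqrt ?V) / 2 + sqrt ?V / 2"
    by simp
  also have "\<dots> = sqrt ?V"
    using real_div_sqrt[of ?V] V by simp
  finally show ?thesis .
qed

text \<open>The binomial theorem in probabilistic form: the n-th power of \<open>T\<close> averages
  the powers of \<open>S\<close> over a binomially distributed exponent. Pascal's rule drives the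
  induction.\<close>

lemma op_power_convex_combination:
  assumes T: "\<And>x. blinfun_apply T x = (1 - p) *\<^sub>R x + p *\<^sub>R blinfun_apply S x"
  shows "blinfun_apply (op_power T n) x = (\<Sum>k\<le>n. Bernstein n k p *\<^sub>R blinfun_apply (op_power S k) x)"
proof (induction n)
  case 0
  show ?case
    by (simp add: Bernstein_def)
next
  case (Suc n)
  let ?v = "\<lambda>k. blinfun_apply (op_power S k) x"
  have "(\<Sum>k\<le>Suc n. Bernstein (Suc n) k p *\<^sub>R ?v k)
      = ((1 - p) * Bernstein n 0 p) *\<^sub>R ?v 0 + (\<Sum>k\<le>n. ((1 - p) * Bernstein n (Suc k) p) *\<^sub>R ?v (Suc k))
        + (\<Sum>k\<le>n. (p * Bernstein n k p) *\<^sub>R ?v (Suc k))"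
    unfolding sum.atMost_Suc_shift Bernstein_Suc_0 Bernstein_Suc_Suc scaleR_left_distrib sum.distrib
    by (simp only: add.assoc)
  also have "\<dots> = (1 - p) *\<^sub>R (\<Sum>k\<le>Suc n. Bernstein n k p *\<^sub>R ?v k)
      + p *\<^sub>R (\<Sum>k\<le>n. Bernstein n k p *\<^sub>R ?v (Suc k))"
    unfolding sum.atMost_Suc_shift
    by (simp only: scaleR_right_distrib scaleR_sum_right scaleR_scaleR)
  also have "(\<Sum>k\<le>n. Bernstein n k p *\<^sub>R ?v (Suc k)) = blinfun_apply S (\<Sum>k\<le>n. Bernstein n k p *\<^sub>R ?v k)"
    by (simp add: op_power_Suc blinfun.sum_right blinfun.scaleR_right)
  finally show ?case
    by (simp add: op_power_Suc T Suc.IH)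
qed

text \<open>
  The coefficients of \<open>(1 - S) ((1 - p) + p S)\<^sup>n\<close> are differences of consecutive binomial
  probabilities, whose absolute sum is the mean deviation of a binomial distribution divided by
  its variance.
\<close>

lemma norm_op_power_diff_le:
  assumes S: "norm S \<le> 1" and p: "0 < p" "p < 1"
    and T: "\<And>x. blinfun_apply T x = (1 - p) *\<^sub>R x + p *\<^sub>R blinfun_apply S x"
  shows "norm (blinfun_apply (op_power T n) (x - blinfun_apply S x))
    \<le> norm x / sqrt (real (Suc n) * p * (1 - p))"
proof -
  let ?v = "\<lambda>k. blinfun_apply (op_power S k) x" and ?B = "\<lambda>k. Bernstein n k p"
    and ?V = "real (Suc n) * p * (1 - p)"
  \<comment> \<open>The coefficient of the k-th power of \<open>S\<close> after summation by parts;
    at k = 0 there is no predecessor to subtract.\<close>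
  define c where "c k = ?B k - (case k of 0 \<Rightarrow> 0 | Suc j \<Rightarrow> ?B j)" for k
  have V: "?V > 0"
    using p by simp
  have c: "?V * c k = (real (Suc n) * p - real k) * Bernstein (Suc n) k p" for k
  proof -
    have "?V * c k = p * (real (Suc n) * (1 - p) * ?B k)
        - (1 - p) * (case k of 0 \<Rightarrow> 0 | Suc j \<Rightarrow> real (Suc n) * p * ?B j)"
      by (simp add: c_def algebra_simps split: nat.split)
    also have "\<dots> = p * ((real (Suc n) - real k) * Bernstein (Suc n) k p)
        - (1 - p) * (real k * Bernstein (Suc n) k p)"
      unfolding Bernstein_Suc_left Bernstein_Suc_right by (simp split: nat.split)
    finally show ?thesis
      by (simp add: algebra_simps)
  qed
  have "blinfun_apply (op_power T n) (x - blinfun_apply S x)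
      = (\<Sum>k\<le>n. ?B k *\<^sub>R (?v k - ?v (Suc k)))"
    by (simp add: op_power_convex_combination[OF T] blinfun.diff_right op_power_Suc op_power_commute
      scaleR_diff_right sum_subtractf)
  \<comment> \<open>The first sum may run to \<open>Suc n\<close> because
    \<open>Bernstein n (Suc n) p\<close> vanishes; both sums then match index by index after a
    shift.\<close>
  also have "\<dots> = (\<Sum>k\<le>Suc n. ?B k *\<^sub>R ?v k) - (\<Sum>k\<le>n. ?B k *\<^sub>R ?v (Suc k))"
    by (simp add: scaleR_diff_right sum_subtractf)
  also have "\<dots> = (\<Sum>k\<le>Suc n. c k *\<^sub>R ?v k)"
    unfolding sum.atMost_Suc_shift c_def by (simp add: scaleR_diff_left sum_subtractf)
  finally have "norm (blinfun_apply (op_power T n) (x - blinfun_apply S x)) \<le> (\<Sum>k\<le>Suc n. norm (c k *\<^sub>R ?v k))"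
    using norm_sum by metis
  also have "\<dots> \<le> (\<Sum>k\<le>Suc n. \<bar>c k\<bar> * norm x)"
  proof (intro sum_mono)
    fix k
    have "norm (?v k) \<le> norm (op_power S k) * norm x"
      by (rule norm_blinfun)
    also have "\<dots> \<le> norm x"
      using norm_op_power_le_1[OF S] by (simp add: mult_left_le_one_le)
    finally show "norm (c k *\<^sub>R ?v k) \<le> \<bar>c k\<bar> * norm x"
      by (simp add: mult_left_mono)
  qed
  also have "\<dots> = (\<Sum>k\<le>Suc n. \<bar>c k\<bar>) * norm x"
    by (simp only: sum_distrib_right)
  also have "(\<Sum>k\<le>Suc n. \<bar>c k\<bar>) = (\<Sum>k\<le>Suc n. \<bar>real k - real (Suc n) * p\<bar> * Bernstein (Suc n) k p / ?V)"
  proof (intro sum.cong refl)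
    fix k
    have "?V * \<bar>c k\<bar> = \<bar>?V * c k\<bar>"
      using V by (metis abs_mult abs_of_pos)
    also have "\<dots> = \<bar>real k - real (Suc n) * p\<bar> * Bernstein (Suc n) k p"
      using Bernstein_nonneg[of p "Suc n" k] p unfolding c abs_mult by (simp add: abs_minus_commute)
    finally show "\<bar>c k\<bar> = \<bar>real k - real (Suc n) * p\<bar> * Bernstein (Suc n) k p / ?V"
      using V by (metis nonzero_mult_div_cancel_left less_irrefl)
  qed
  also have "\<dots> \<le> sqrt ?V / ?V"
    using sum_Bernstein_mean_deviation[OF p, of n] V
    unfolding sum_divide_distrib[symmetric] by (intro divide_right_mono) auto
  also have "sqrt ?V / ?V = 1 / sqrt ?V"
    using sqrt_divide_self_eq[of ?V] V by (simp only: inverse_eq_divide less_imp_le)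
  finally show ?thesis
    by (simp add: mult_right_mono)
qed

section \<open>Operators at distance less than one from a multiple of the identity\<close>

text \<open>Not naming the contraction \<open>(R - a I) / (1 - a)\<close> reduces stability under
  products and convex combinations to triangle inequalities.\<close>

definition averaged_ops :: "('a::real_normed_vector \<Rightarrow>\<^sub>L 'a) set"
  where "averaged_ops = {R. \<exists>a. 0 < a \<and> a < 1 \<and> norm (R - a *\<^sub>R id_blinfun) \<le> 1 - a}"

text \<open>Weights multiply: the three terms left beside \<open>a * b\<close> times the identity
  have norms adding up to at most \<open>1 - a * b\<close>.\<close>

lemma averaged_ops_compose:
  assumes "R \<in> averaged_ops" "Q \<in> averaged_ops"
  shows "R o\<^sub>L Q \<in> averaged_ops"
proof -
  obtain a b where a: "0 < a" "a < 1" "norm (R - a *\<^sub>R id_blinfun) \<le> 1 - a"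
    and b: "0 < b" "b < 1" "norm (Q - b *\<^sub>R id_blinfun) \<le> 1 - b"
    using assms by (auto simp: averaged_ops_def)
  let ?R = "R - a *\<^sub>R id_blinfun" and ?Q = "Q - b *\<^sub>R id_blinfun"
  have "(R o\<^sub>L Q) - (a * b) *\<^sub>R id_blinfun = a *\<^sub>R ?Q + b *\<^sub>R ?R + (?R o\<^sub>L ?Q)"
    by (rule blinfun_eqI)
       (simp add: blinfun.add_left blinfun.diff_left blinfun.diff_right blinfun.scaleR_left blinfun.scaleR_right
         algebra_simps)
  also have "norm \<dots> \<le> a * norm ?Q + b * norm ?R + norm ?R * norm ?Q"
    using a(1) b(1) norm_blinfun_compose[of ?R ?Q]
    by (intro order_trans[OF norm_triangle_ineq] add_mono) auto
  also have "\<dots> \<le> a * (1 - b) + b * (1 - a) + (1 - a) * (1 - b)"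
    using a b by (intro add_mono mult_left_mono mult_mono) auto
  also have "\<dots> = 1 - a * b"
    by (simp add: algebra_simps)
  finally show ?thesis
    using a b mult_strict_mono[of a 1 b 1] by (auto simp: averaged_ops_def intro!: exI[of _ "a * b"])
qed

lemma op_products_subset_averaged_ops:
  assumes "A \<subseteq> averaged_ops" shows "op_products A \<subseteq> averaged_ops"
proof
  fix R assume "R \<in> op_products A"
  then show "R \<in> averaged_ops"
    using assms by induction (auto intro: averaged_ops_compose)
qed

lemma convex_averaged_ops: "convex averaged_ops"
proof (rule convexI)
  fix R Q :: "'a \<Rightarrow>\<^sub>L 'a" and u v :: real
  assume R: "R \<in> averaged_ops" and Q: "Q \<in> averaged_ops" and uv: "0 \<le> u" "0 \<le> v" "u + v = 1"
  obtain a b where a: "0 < a" "a < 1" "norm (R - a *\<^sub>R id_blinfun) \<le> 1 - a"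
    and b: "0 < b" "b < 1" "norm (Q - b *\<^sub>R id_blinfun) \<le> 1 - b"
    using R Q by (auto simp: averaged_ops_def)
  let ?c = "u * a + v * b"
  have "u *\<^sub>R R + v *\<^sub>R Q - ?c *\<^sub>R id_blinfun = u *\<^sub>R (R - a *\<^sub>R id_blinfun) + v *\<^sub>R (Q - b *\<^sub>R id_blinfun)"
    by (simp add: algebra_simps)
  also have "norm \<dots> \<le> u * (1 - a) + v * (1 - b)"
    using uv a b by (intro order_trans[OF norm_triangle_ineq] add_mono) (auto intro: mult_left_mono)
  also have "\<dots> = 1 - ?c"
    using uv by (simp add: algebra_simps)
  finally have "norm (u *\<^sub>R R + v *\<^sub>R Q - ?c *\<^sub>R id_blinfun) \<le> 1 - ?c" .
  moreover have "0 < ?c" "?c < 1"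
    using uv a b convex_bound_lt[of a 1 b u v] convex_bound_lt[of "-a" 0 "-b" u v] by auto
  ultimately show "u *\<^sub>R R + v *\<^sub>R Q \<in> averaged_ops"
    by (auto simp: averaged_ops_def)
qed

lemma T_pair_mem_averaged_ops:
  fixes P :: "'i \<Rightarrow> 'a::complex_normed_vector \<Rightarrow>\<^sub>L 'a"
  assumes "type_U_projection (P k)" "type_U_projection (P l)"
  shows "T_pair P k l \<in> averaged_ops"
proof -
  let ?H = "\<lambda>k. P k - (1/2) *\<^sub>R id_blinfun"
  have "T_pair P k l - (1/2) *\<^sub>R id_blinfun = 2 *\<^sub>R (?H k o\<^sub>L ?H l)"
  proof (rule blinfun_eqI)
    fix x :: 'a
    have "x = (1/2) *\<^sub>R x + (1/2) *\<^sub>R x"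
      by (simp only: scaleR_half_double flip: scaleR_right_distrib)
    then show "blinfun_apply (T_pair P k l - (1/2) *\<^sub>R id_blinfun) x
        = blinfun_apply (2 *\<^sub>R (?H k o\<^sub>L ?H l)) x"
      by (simp add: T_pair_def blinfun.add_left blinfun.diff_left blinfun.diff_right blinfun.scaleR_left
         blinfun.scaleR_right scaleR_diff_right)
        (simp add: algebra_simps scaleR_2)
  qed
  also have "norm \<dots> \<le> 2 * (norm (?H k) * norm (?H l))"
    using norm_blinfun_compose[of "?H k" "?H l"] by simp
  also have "\<dots> \<le> 2 * ((1/2) * (1/2))"
    using assms by (intro mult_left_mono mult_mono) (auto simp: type_U_projection_def)
  finally show ?thesis
    by (auto simp: averaged_ops_def intro!: exI[of _ "1/2"])
qed

lemma averaged_ops_norm_le_1: "R \<in> averaged_ops \<Longrightarrow> norm R \<le> 1"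
proof -
  assume "R \<in> averaged_ops"
  then obtain a where a: "0 < a" "a < 1" "norm (R - a *\<^sub>R id_blinfun) \<le> 1 - a"
    by (auto simp: averaged_ops_def)
  have "norm R \<le> norm (R - a *\<^sub>R id_blinfun) + norm (a *\<^sub>R (id_blinfun :: 'a \<Rightarrow>\<^sub>L 'a))"
    using norm_triangle_ineq[of "R - a *\<^sub>R id_blinfun" "a *\<^sub>R id_blinfun"] by simp
  also have "\<dots> \<le> (1 - a) + a * 1"
    using a norm_blinfun_id_le[where 'a = 'a] by (intro add_mono) (simp_all add: mult_left_le)
  finally show ?thesis by simp
qed

lemma averaged_ops_decay:
  assumes "R \<in> averaged_ops"
  obtains K where "K > 0" "\<And>n. norm (op_power R n o\<^sub>L (id_blinfun - R)) \<le> K / sqrt (real (Suc n))"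
proof -
  obtain a where a: "0 < a" "a < 1" "norm (R - a *\<^sub>R id_blinfun) \<le> 1 - a"
    using assms by (auto simp: averaged_ops_def)
  define p where "p = 1 - a"
  define S where "S = (1 / p) *\<^sub>R (R - a *\<^sub>R id_blinfun)"
  have p: "0 < p" "p < 1"
    using a by (auto simp: p_def)
  have S: "norm S \<le> 1"
    using a by (simp add: S_def p_def)
  have RS: "blinfun_apply R x = (1 - p) *\<^sub>R x + p *\<^sub>R blinfun_apply S x" for x
    using p by (simp add: S_def p_def blinfun.scaleR_left blinfun.diff_left)
  have diff: "x - blinfun_apply R x = p *\<^sub>R (x - blinfun_apply S x)" for x
    by (simp add: RS algebra_simps)
  \<comment> \<open>The numerator comes from \<open>I - R = p (I - S)\<close>, the root from the
    variance \<open>p * (1 - p)\<close> of a single trial.\<close>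
  let ?K = "p / sqrt (p * (1 - p))"
  have "norm (op_power R n o\<^sub>L (id_blinfun - R)) \<le> ?K / sqrt (real (Suc n))" for n
  proof (rule norm_blinfun_bound)
    show "0 \<le> ?K / sqrt (real (Suc n))"
      using p by simp
    fix x
    have "norm (blinfun_apply (op_power R n o\<^sub>L (id_blinfun - R)) x)
        = p * norm (blinfun_apply (op_power R n) (x - blinfun_apply S x))"
      using p by (simp add: blinfun.diff_left diff blinfun.scaleR_right)
    also have "\<dots> \<le> p * (norm x / sqrt (real (Suc n) * p * (1 - p)))"
      using p by (intro mult_left_mono norm_op_power_diff_le[OF S p RS]) auto
    also have "\<dots> = ?K / sqrt (real (Suc n)) * norm x"
      by (simp add: real_sqrt_mult mult.assoc del: of_nat_Suc)
    finally show "norm (blinfun_apply (op_power R n o\<^sub>L (id_blinfun - R)) x) \<le> ?K / sqrt (real (Suc n)) * norm x" .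
  qed
  moreover have "?K > 0"
    using p by simp
  ultimately show thesis
    using that by blast
qed

section \<open>The mean ergodic decomposition\<close>

locale averaged_operator =
  fixes T :: "'a::cbanach \<Rightarrow>\<^sub>L 'a"
  assumes reflexive: "reflexive_space TYPE('a)"
    and T_cbounded: "T \<in> cbounded_ops"
    and averaged: "T \<in> averaged_ops"
begin

abbreviation A :: "'a \<Rightarrow>\<^sub>L 'a" where "A \<equiv> id_blinfun - T"
abbreviation Z :: "'a set" where "Z \<equiv> closure (op_ran A)"
abbreviation d :: "nat \<Rightarrow> real" where "d n \<equiv> norm (op_power T n o\<^sub>L A)"

lemma A_apply: "A x = x - T x"
  by (simp add: blinfun.diff_left)

lemma A_cbounded: "A \<in> cbounded_ops"
  using T_cbounded by (simp add: cbounded_ops_diff)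

lemma norm_power_le: "norm (op_power T n x) \<le> norm x"
proof -
  have "norm (op_power T n x) \<le> norm (op_power T n) * norm x"
    by (rule norm_blinfun)
  also have "\<dots> \<le> 1 * norm x"
    using norm_op_power_le_1[OF averaged_ops_norm_le_1[OF averaged]] by (intro mult_right_mono) auto
  finally show ?thesis by simp
qed

lemma norm_A_le: "norm (A x) \<le> 2 * norm x"
  using norm_triangle_ineq4[of x "T x"] norm_power_le[of 1 x] by (simp add: A_apply op_power_Suc)

lemma power_A_commute: "op_power T n (A x) = A (op_power T n x)"
  by (simp add: A_apply blinfun.diff_right op_power_commute)

lemma d_bound: "\<exists>K>0. \<forall>n. d n \<le> K / sqrt (real (Suc n))"
  using averaged_ops_decay[OF averaged] by metis

lemma d_tendsto_0: "d \<longlonglongrightarrow> 0"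
proof -
  obtain K where K: "\<And>n. d n \<le> K / sqrt (real (Suc n))"
    using d_bound by blast
  have "(\<lambda>n. K * sqrt (inverse (real (Suc n)))) \<longlonglongrightarrow> K * sqrt 0"
    by (intro tendsto_intros LIMSEQ_inverse_real_of_nat)
  then have "(\<lambda>n. K / sqrt (real (Suc n))) \<longlonglongrightarrow> 0"
    by (simp add: real_sqrt_inverse divide_inverse del: of_nat_Suc)
  then show ?thesis
    using K by (intro tendsto_sandwich[of "\<lambda>_. 0" d _ "\<lambda>n. K / sqrt (real (Suc n))"]) auto
qed

lemma norm_power_A_le: "norm (op_power T n (A x)) \<le> d n * norm x"
  using norm_blinfun[of "op_power T n o\<^sub>L A" x] by simp

lemma A_mem_Z: "A x \<in> Z"
  using closure_subset by (force simp: op_ran_def)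

lemma csubspace_Z: "csubspace Z"
  by (intro csubspace_closure csubspace_op_ran A_cbounded)

lemmas Z_add = complex_vector.subspace_add[OF csubspace_Z]
lemmas Z_diff = complex_vector.subspace_diff[OF csubspace_Z]
lemmas Z_scaleR = subspace_scale[OF csubspace_subspace[OF csubspace_Z]]

lemma Z_approx:
  assumes "z \<in> Z" "e > 0" obtains w where "norm (z - A w) < e"
  using assms by (auto simp: closure_approachable op_ran_def dist_norm norm_minus_commute)

text \<open>On the range of \<open>A\<close> this is the decay of \<open>d\<close>; contractivity of
  the powers carries it to the closure.\<close>

lemma power_tendsto_0:
  assumes "z \<in> Z" shows "(\<lambda>n. op_power T n z) \<longlonglongrightarrow> 0"
proof (rule LIMSEQ_I)
  fix e :: real assume "e > 0"
  then obtain w where w: "norm (z - A w) < e / 2"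
    using Z_approx[OF assms, of "e / 2"] by auto
  have "(\<lambda>n. d n * norm w) \<longlonglongrightarrow> 0"
    using d_tendsto_0 by (auto intro: tendsto_eq_intros)
  then have "\<forall>\<^sub>F n in sequentially. d n * norm w < e / 2"
    using \<open>e > 0\<close> by (intro order_tendstoD) auto
  then obtain N where N: "\<And>n. n \<ge> N \<Longrightarrow> d n * norm w < e / 2"
    by (auto simp: eventually_sequentially)
  have "norm (op_power T n z - 0) < e" if "n \<ge> N" for n
  proof -
    have "norm (op_power T n z) \<le> norm (op_power T n (z - A w)) + norm (op_power T n (A w))"
      using norm_triangle_ineq[of "op_power T n (z - A w)" "op_power T n (A w)"]
      by (simp flip: blinfun.add_right)
    also have "\<dots> < e"
      using norm_power_le[of n "z - A w"] norm_power_A_le[of n w] w N[OF that] by simp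
    finally show ?thesis by simp
  qed
  then show "\<exists>N. \<forall>n\<ge>N. norm (op_power T n z - 0) < e"
    by blast
qed

lemma power_fixed: "T y = y \<Longrightarrow> op_power T n y = y"
  by (induction n) (simp_all add: op_power_Suc)

lemma power_mem_Z: "z \<in> Z \<Longrightarrow> op_power T n z \<in> Z"
proof (induction n)
  case (Suc n)
  then show ?case
    using Z_diff[OF Suc.IH A_mem_Z, of "op_power T n z"] by (simp add: op_power_Suc A_apply)
qed simp

lemma functional_power_eq:
  assumes "\<And>z. z \<in> Z \<Longrightarrow> blinfun_apply \<phi> z = 0"
  shows "\<phi> (op_power T n x) = \<phi> x"
proof (induction n)
  case (Suc n)
  then show ?case
    using assms[OF A_mem_Z, of "op_power T n x"]
    by (simp add: op_power_Suc A_apply blinfun.diff_right)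
qed simp

text \<open>
  A Banach limit in disguise: a linear functional below the upper limit of \<open>Re (\<phi> (T\<^sup>n x))\<close> is, by
  reflexivity, evaluation at a point, and that point is the fixed component of \<open>x\<close>.
\<close>

lemma mean_ergodic:
  fixes x :: 'a
  obtains y where "T y = y" "x - y \<in> Z"
proof -
  \<comment> \<open>Eventual upper bounds of the orbit seen through \<open>\<phi>\<close>: their
    infimum \<open>p\<close> is the upper limit, and its sublinearity reduces to adding and scaling
    bounds.\<close>
  define C where "C \<phi> = {c. \<forall>\<^sub>F n in sequentially. Re (blinfun_apply \<phi> (op_power T n x)) \<le> c}"
    for \<phi> :: "'a \<Rightarrow>\<^sub>L complex"
  define p where "p \<phi> = Inf (C \<phi>)" for \<phi> :: "'a \<Rightarrow>\<^sub>L complex"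
  have abs_le: "\<bar>Re (blinfun_apply \<phi> (op_power T n x))\<bar> \<le> norm x * norm \<phi>" for \<phi> :: "'a \<Rightarrow>\<^sub>L complex" and n
  proof -
    have "\<bar>Re (blinfun_apply \<phi> (op_power T n x))\<bar> \<le> norm \<phi> * norm (op_power T n x)"
      using abs_Re_le_cmod norm_blinfun order_trans by blast
    also have "\<dots> \<le> norm \<phi> * norm x"
      by (intro mult_left_mono norm_power_le) auto
    finally show ?thesis
      by (simp add: mult.commute)
  qed
  have ge: "- (norm x * norm \<phi>) \<le> c" if "c \<in> C \<phi>" for c \<phi>
  proof -
    obtain n where "Re (blinfun_apply \<phi> (op_power T n x)) \<le> c"
      using \<open>c \<in> C \<phi>\<close> by (auto simp: C_def eventually_sequentially)
    then show ?thesis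
      using abs_le[of \<phi> n] by simp
  qed
  have norm_C: "norm x * norm \<phi> \<in> C \<phi>" for \<phi>
    using abs_le[of \<phi>] by (auto simp: C_def abs_le_iff)
  have p_le: "p \<phi> \<le> c" if "c \<in> C \<phi>" for c \<phi>
    unfolding p_def using ge by (intro cInf_lower[OF that] bdd_belowI)
  have p_greatest: "m \<le> p \<phi>" if "\<And>c. c \<in> C \<phi> \<Longrightarrow> m \<le> c" for m \<phi>
    unfolding p_def using norm_C that by (intro cInf_greatest) auto
  have "sublinear p"
  proof (rule sublinearI)
    fix \<phi> \<psi>
    have "a + b \<in> C (\<phi> + \<psi>)" if "a \<in> C \<phi>" "b \<in> C \<psi>" for a b
      using that unfolding C_def mem_Collect_eq
      by eventually_elim (simp add: blinfun.add_left)
    then have "p (\<phi> + \<psi>) - b \<le> a" if "a \<in> C \<phi>" "b \<in> C \<psi>" for a b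
      using p_le[of "a + b" "\<phi> + \<psi>"] that by fastforce
    then have "p (\<phi> + \<psi>) - b \<le> p \<phi>" if "b \<in> C \<psi>" for b
      using that by (intro p_greatest)
    then have "p (\<phi> + \<psi>) - p \<phi> \<le> p \<psi>"
      by (intro p_greatest) (simp add: algebra_simps)
    then show "p (\<phi> + \<psi>) \<le> p \<phi> + p \<psi>"
      by simp
  next
    fix c :: real and \<phi> assume c: "c > 0"
    have "c * a \<in> C (c *\<^sub>R \<phi>)" if "a \<in> C \<phi>" for a
      using that unfolding C_def mem_Collect_eq
      by eventually_elim (use c in \<open>simp add: blinfun.scaleR_left\<close>)
    then have "p (c *\<^sub>R \<phi>) / c \<le> a" if "a \<in> C \<phi>" for a
      using p_le[of "c * a" "c *\<^sub>R \<phi>"] that c by (simp add: field_simps)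
    then have "p (c *\<^sub>R \<phi>) / c \<le> p \<phi>"
      by (rule p_greatest)
    then show "p (c *\<^sub>R \<phi>) \<le> c * p \<phi>"
      using c by (simp add: field_simps)
  qed
  then obtain f where f: "linear f" "\<And>\<phi>. f \<phi> \<le> p \<phi>"
    using Hahn_Banach_sublinear by metis
  have f_le: "f \<phi> \<le> c" if "c \<in> C \<phi>" for c \<phi>
    using f(2) p_le[OF that] by (rule order_trans)
  have "\<bar>f \<phi>\<bar> \<le> norm x * norm \<phi>" for \<phi>
    using f_le[OF norm_C, of \<phi>] f_le[OF norm_C, of "-\<phi>"] by (simp add: linear_neg[OF f(1)])
  then obtain y where y: "\<And>\<phi>. \<phi> \<in> cdual \<Longrightarrow> f \<phi> = Re (blinfun_apply \<phi> y)"
    using reflexive_represents[OF reflexive f(1)] by metis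
  have "A y = 0"
  proof (rule eq_zero_if_annihilated)
    fix \<phi> :: "'a \<Rightarrow>\<^sub>L complex" assume \<phi>: "\<phi> \<in> cdual"
    have lim: "(\<lambda>n. Re (blinfun_apply \<psi> (op_power T n (A x)))) \<longlonglongrightarrow> 0" for \<psi> :: "'a \<Rightarrow>\<^sub>L complex"
    proof -
      have "(\<lambda>n. Re (blinfun_apply \<psi> (op_power T n (A x)))) \<longlonglongrightarrow> Re (blinfun_apply \<psi> 0)"
        by (intro tendsto_intros power_tendsto_0 A_mem_Z)
      then show ?thesis
        by (simp add: blinfun.zero_right)
    qed
    have "f (\<psi> o\<^sub>L A) \<le> 0" for \<psi> :: "'a \<Rightarrow>\<^sub>L complex"
    proof (rule field_le_epsilon)
      fix e :: real assume "e > 0"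
      then have "\<forall>\<^sub>F n in sequentially. Re (blinfun_apply \<psi> (op_power T n (A x))) < e"
        using lim by (intro order_tendstoD)
      then have "e \<in> C (\<psi> o\<^sub>L A)"
        unfolding C_def mem_Collect_eq by eventually_elim (simp add: power_A_commute)
      then show "f (\<psi> o\<^sub>L A) \<le> 0 + e"
        using f_le by simp
    qed
    from this[of \<phi>] this[of "-\<phi>"] have "f (\<phi> o\<^sub>L A) = 0"
      by (simp add: bounded_bilinear.minus_left[OF bounded_bilinear_blinfun_compose] linear_neg[OF f(1)])
    then show "Re (blinfun_apply \<phi> (A y)) = 0"
      using y[OF cbounded_ops_compose[OF \<phi> A_cbounded]] by simp
  qed
  moreover have "x - y \<in> Z"
  proof (rule mem_closed_csubspace_if_annihilated[OF csubspace_Z closed_closure])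
    fix \<phi> :: "'a \<Rightarrow>\<^sub>L complex"
    assume \<phi>: "\<phi> \<in> cdual" and Z: "\<And>z. z \<in> Z \<Longrightarrow> blinfun_apply \<phi> z = 0"
    \<comment> \<open>A functional annihilating \<open>Z\<close> is constant along orbits, so the
      bounds for \<open>\<phi>\<close> and \<open>- \<phi>\<close> determine
      \<open>f \<phi>\<close>.\<close>
    have "Re (\<phi> x) \<in> C \<phi>" "- Re (\<phi> x) \<in> C (- \<phi>)"
      using functional_power_eq[of \<phi>, OF Z] by (simp_all add: C_def blinfun.minus_left)
    from this[THEN f_le] have "f \<phi> = Re (\<phi> x)"
      by (simp add: linear_neg[OF f(1)])
    then show "Re (blinfun_apply \<phi> (x - y)) = 0"
      using y[OF \<phi>] by (simp add: blinfun.diff_right)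
  qed
  ultimately show thesis
    by (intro that[of y]) (simp_all add: A_apply)
qed

section \<open>The ergodic projection\<close>

definition proj :: "'a \<Rightarrow>\<^sub>L 'a"
  where "proj = Blinfun (\<lambda>x. lim (\<lambda>n. op_power T n x))"

lemma proj_decomposition:
  shows power_tendsto_proj: "(\<lambda>n. op_power T n x) \<longlonglongrightarrow> proj x"
    and T_proj: "T (proj x) = proj x"
    and diff_proj_mem_Z: "x - proj x \<in> Z"
proof -
  have lim: "(\<lambda>n. op_power T n u) \<longlonglongrightarrow> v" if "T v = v" "u - v \<in> Z" for u v
  proof -
    have "(\<lambda>n. v + op_power T n (u - v)) \<longlonglongrightarrow> v + 0"
      by (intro tendsto_intros power_tendsto_0 that)
    then show ?thesis
      by (simp add: blinfun.diff_right power_fixed that)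
  qed
  have conv: "convergent (\<lambda>n. op_power T n u)" for u
    using mean_ergodic[of u] lim convergentI by metis
  \<comment> \<open>Linearity and the bound 1 pass to the pointwise limit from the powers.\<close>
  have "bounded_linear (\<lambda>x. lim (\<lambda>n. op_power T n x))"
  proof (rule bounded_linear_intro[where K = 1])
    show "lim (\<lambda>n. op_power T n (u + v)) = lim (\<lambda>n. op_power T n u) + lim (\<lambda>n. op_power T n v)" for u v
      by (intro limI) (simp add: blinfun.add_right tendsto_add conv convergent_LIMSEQ_iff[THEN iffD1])
    show "lim (\<lambda>n. op_power T n (r *\<^sub>R u)) = r *\<^sub>R lim (\<lambda>n. op_power T n u)" for r u
      by (intro limI) (simp add: blinfun.scaleR_right tendsto_scaleR conv convergent_LIMSEQ_iff[THEN iffD1])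
    show "norm (lim (\<lambda>n. op_power T n u)) \<le> norm u * 1" for u
      using conv[of u] norm_power_le
      by (intro LIMSEQ_le_const2[OF tendsto_norm]) (auto simp: convergent_LIMSEQ_iff)
  qed
  then have "blinfun_apply proj = (\<lambda>x. lim (\<lambda>n. op_power T n x))"
    by (simp add: proj_def bounded_linear_Blinfun_apply)
  then have proj: "proj x = y" if "T y = y" "x - y \<in> Z" for y
    using limI[OF lim[OF that]] by simp
  obtain y where y: "T y = y" "x - y \<in> Z"
    by (rule mean_ergodic)
  show "(\<lambda>n. op_power T n x) \<longlonglongrightarrow> proj x" "T (proj x) = proj x" "x - proj x \<in> Z"
    using y lim[OF y] proj[OF y] by simp_all
qed

lemma proj_eqI: "T y = y \<Longrightarrow> x - y \<in> Z \<Longrightarrow> proj x = y"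
proof -
  assume y: "T y = y" and "x - y \<in> Z"
  then have "(\<lambda>n. y + op_power T n (x - y)) \<longlonglongrightarrow> y + 0"
    by (intro tendsto_intros power_tendsto_0)
  then show ?thesis
    using LIMSEQ_unique[OF power_tendsto_proj] by (simp add: blinfun.diff_right power_fixed[OF y])
qed

lemma Z_0: "0 \<in> Z"
  using csubspace_Z by (simp add: complex_vector.subspace_def)

lemma proj_fixed: "T y = y \<Longrightarrow> proj y = y"
  by (rule proj_eqI) (simp_all add: Z_0)

lemma proj_Z: "z \<in> Z \<Longrightarrow> proj z = 0"
  by (rule proj_eqI) (simp_all add: blinfun.zero_right)

lemma mem_op_fix: "y \<in> op_fix T \<longleftrightarrow> T y = y"
  by (auto simp: op_fix_def op_ker_def blinfun.diff_left)

lemma proj_cbounded: "proj \<in> cbounded_ops"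
  unfolding cbounded_ops_iff
proof (intro allI)
  fix c x
  have "T (c *\<^sub>C proj x) = c *\<^sub>C proj x"
    using T_cbounded by (simp add: cbounded_ops_iff T_proj)
  moreover have "c *\<^sub>C x - c *\<^sub>C proj x \<in> Z"
    using complex_vector.subspace_scale[OF csubspace_Z diff_proj_mem_Z] by (simp add: scaleC_diff_right)
  ultimately show "proj (c *\<^sub>C x) = c *\<^sub>C proj x"
    by (rule proj_eqI)
qed

lemma norm_proj_apply_le: "norm (proj x) \<le> norm x"
  using norm_power_le by (intro LIMSEQ_le_const2[OF tendsto_norm[OF power_tendsto_proj]]) auto

lemma is_projection_proj: "is_projection proj"
  by (auto simp: is_projection_def proj_cbounded intro!: blinfun_eqI proj_fixed T_proj)

lemma orthoprojection_proj: "orthoprojection proj"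
  unfolding orthoprojection_def using is_projection_proj norm_proj_apply_le
  by (auto intro: norm_blinfun_bound)

lemma projection_onto_along_proj: "projection_onto_along proj (op_fix T) Z"
  unfolding projection_onto_along_def
proof (intro conjI is_projection_proj)
  show "op_ran proj = op_fix T"
    using T_proj proj_fixed by (auto simp: op_ran_def mem_op_fix image_iff) (metis)
  show "op_ker proj = Z"
  proof (intro equalityI subsetI)
    show "x \<in> Z" if "x \<in> op_ker proj" for x
      using that diff_proj_mem_Z[of x] by (simp add: op_ker_def)
  qed (simp add: op_ker_def proj_Z)
qed

lemma is_direct_sum_fix_Z: "is_direct_sum (op_fix T) Z"
  unfolding is_direct_sum_def
proof (intro conjI csubspace_Z)
  show "csubspace (op_fix T)"
    unfolding op_fix_def by (intro csubspace_op_ker A_cbounded)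
  have "y = 0" if "T y = y" "y \<in> Z" for y
    using proj_fixed[OF that(1)] proj_Z[OF that(2)] by simp
  then show "op_fix T \<inter> Z = {0}"
    by (auto simp: mem_op_fix Z_0 blinfun.zero_right)
  have "\<exists>y z. x = y + z \<and> y \<in> op_fix T \<and> z \<in> Z" for x
    using T_proj[of x] diff_proj_mem_Z[of x]
    by (intro exI[of _ "proj x"] exI[of _ "x - proj x"]) (simp add: mem_op_fix)
  then show "{y + z |y z. y \<in> op_fix T \<and> z \<in> Z} = UNIV"
    by blast
qed

lemma power_diff_proj: "(op_power T n - proj) x = op_power T n (x - proj x)"
  by (simp add: blinfun.diff_left blinfun.diff_right power_fixed[OF T_proj])

end

section \<open>Slow convergence\<close>

lemma geometric_increments_converge:
  fixes X :: "nat \<Rightarrow> 'b::banach"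
  assumes incr: "\<And>l. norm (X (Suc l) - X l) \<le> C * a ^ l" and a: "0 \<le> a" "a < 1"
  obtains L where "X \<longlonglongrightarrow> L" "norm (L - X 0) \<le> C / (1 - a)"
proof -
  let ?D = "\<lambda>l. X (Suc l) - X l"
  have geometric: "(\<lambda>l. C * a ^ l) sums (C / (1 - a))"
    using sums_mult[OF geometric_sums[of a], of C] a by simp
  then have sum: "summable ?D"
    using incr by (intro summable_comparison_test[of ?D "\<lambda>l. C * a ^ l"]) (auto simp: sums_iff)
  have "(\<lambda>n. X 0 + (\<Sum>l<n. ?D l)) \<longlonglongrightarrow> X 0 + suminf ?D"
    using summable_LIMSEQ[OF sum] by (intro tendsto_intros)
  then have "X \<longlonglongrightarrow> X 0 + suminf ?D"
    by (simp add: sum_lessThan_telescope)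
  moreover have "norm (suminf ?D) \<le> C / (1 - a)"
    using norm_suminf_le[of ?D "\<lambda>l. C * a ^ l", OF incr] geometric by (simp add: sums_iff)
  ultimately show thesis
    using that by simp
qed

lemma weakly_arbitrarily_slow_imp_arbitrarily_slow:
  assumes "weakly_arbitrarily_slow S" shows "arbitrarily_slow S"
  unfolding arbitrarily_slow_def
proof (intro allI impI)
  fix r :: "nat \<Rightarrow> real"
  assume "\<forall>n. 0 \<le> r n" "r \<longlonglongrightarrow> 0"
  then obtain x \<phi> where r: "\<And>n. r n \<le> Re (blinfun_apply \<phi> (blinfun_apply (S n) x))"
    using assms unfolding weakly_arbitrarily_slow_def by blast
  \<comment> \<open>Scaling the vector by \<open>norm \<phi>\<close> absorbs the norm of the
    functional.\<close>
  have "r n \<le> norm (blinfun_apply (S n) (norm \<phi> *\<^sub>R x))" for n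
  proof -
    have "r n \<le> cmod (blinfun_apply \<phi> (blinfun_apply (S n) x))"
      using r complex_Re_le_cmod by (rule order_trans)
    also have "\<dots> \<le> norm \<phi> * norm (blinfun_apply (S n) x)"
      by (rule norm_blinfun)
    finally show ?thesis
      by (simp add: blinfun.scaleR_right)
  qed
  then show "\<exists>x. \<forall>n. r n \<le> norm (blinfun_apply (S n) x)"
    by blast
qed

context averaged_operator
begin

definition bounded_below :: bool
  where "bounded_below \<longleftrightarrow> (\<exists>c>0. \<forall>z\<in>Z. norm z \<le> c * norm (A z))"

section \<open>Approximate eigenvectors of the operator and its adjoint\<close>

lemma approximate_eigenvector:
  assumes "\<not> bounded_below" "e > 0"
  obtains u where "u \<in> Z" "norm u = 1" "norm (A u) < e"
proof -
  obtain z where z: "z \<in> Z" "norm z > (1 / e) * norm (A z)"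
    using assms unfolding bounded_below_def by (meson not_le zero_less_divide_1_iff)
  then have "norm z > 0"
    using assms(2) by (metis norm_zero blinfun.zero_right mult_zero_right less_irrefl zero_less_norm_iff)
  then show thesis
    using z assms(2) by (intro that[of "(1 / norm z) *\<^sub>R z"])
      (simp_all add: Z_scaleR blinfun.scaleR_right field_simps)
qed

text \<open>The ergodic decomposition of the adjoint. A functional detecting the distance from
  \<open>F - (F o\<^sub>L proj)\<close> to the range of the adjoint of \<open>A\<close> is
  evaluation at some \<open>y\<close>; vanishing on that range means \<open>A y = 0\<close>, so
  \<open>proj y = y\<close> and the distance is 0.\<close>

lemma dual_ergodic:
  fixes F :: "'a \<Rightarrow>\<^sub>L complex"
  assumes F: "F \<in> cdual" and "e > 0"
  obtains \<zeta> :: "'a \<Rightarrow>\<^sub>L complex" where "norm (F - (F o\<^sub>L proj) - (\<zeta> o\<^sub>L A)) < e"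
proof -
  let ?W = "(\<lambda>\<zeta>::'a \<Rightarrow>\<^sub>L complex. \<zeta> o\<^sub>L A) ` cdual" and ?a = "F - (F o\<^sub>L proj)"
  have W: "subspace ?W"
    by (intro linear_subspace_image csubspace_subspace csubspace_cbounded_ops linearI)
       (auto simp: bounded_bilinear.add_left[OF bounded_bilinear_blinfun_compose] bounded_bilinear.scaleR_left[OF bounded_bilinear_blinfun_compose])
  obtain f where f: "linear f" "\<And>x. \<bar>f x\<bar> \<le> norm x" "\<And>w. w \<in> ?W \<Longrightarrow> f w = 0" "f ?a = infdist ?a ?W"
    using Hahn_Banach_infdist[OF W] by metis
  obtain y where y: "\<And>\<phi>. \<phi> \<in> cdual \<Longrightarrow> f \<phi> = Re (blinfun_apply \<phi> y)"
    using reflexive_represents[OF reflexive f(1), of 1] f(2) by auto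
  have "A y = 0"
  proof (rule eq_zero_if_annihilated)
    fix \<phi> :: "'a \<Rightarrow>\<^sub>L complex" assume \<phi>: "\<phi> \<in> cdual"
    then show "Re (blinfun_apply \<phi> (A y)) = 0"
      using f(3)[of "\<phi> o\<^sub>L A"] y[OF cbounded_ops_compose[OF \<phi> A_cbounded]] by auto
  qed
  then have "proj y = y"
    by (intro proj_fixed) (simp add: A_apply)
  then have "infdist ?a ?W = 0"
    using y[OF cbounded_ops_diff[OF F cbounded_ops_compose[OF F proj_cbounded]]] f(4)
    by (simp add: blinfun.diff_left)
  then have "?a \<in> closure ?W"
    using subspace_0[OF W] by (subst in_closure_iff_infdist_zero) auto
  then show thesis
    using that \<open>e > 0\<close> by (auto simp: closure_approachable dist_norm norm_minus_commute)
qed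

lemma norm_power_diff_le: "norm (op_power T n u - u) \<le> real n * norm (A u)"
proof (induction n)
  case (Suc n)
  have "op_power T (Suc n) u - u = (op_power T n u - u) - op_power T n (A u)"
    by (simp add: op_power_Suc op_power_commute A_apply blinfun.diff_right)
  then have "norm (op_power T (Suc n) u - u) \<le> norm (op_power T n u - u) + norm (op_power T n (A u))"
    using norm_triangle_ineq4 by metis
  also have "\<dots> \<le> real n * norm (A u) + norm (A u)"
    by (intro add_mono Suc.IH norm_power_le)
  finally show ?case
    by (simp add: algebra_simps)
qed simp

text \<open>
  Composing a functional that norms an approximate eigenvector \<open>u\<close> with a high power of \<open>T\<close> makes it
  an approximate eigenvector of the adjoint. Approximate eigenvectors almost annihilate the orbits
  of a given functional and a given vector, so no biorthogonalisation is needed.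
\<close>

lemma slow_pair:
  fixes F :: "'a \<Rightarrow>\<^sub>L complex"
  assumes A: "\<not> bounded_below" and X: "X \<in> Z" and F: "F \<in> cdual" and e: "e > 0"
  obtains u and \<phi> :: "'a \<Rightarrow>\<^sub>L complex" where "u \<in> Z" "norm u = 1" "\<phi> \<in> cdual" "norm \<phi> \<le> 2"
    "\<And>n. n \<le> N \<Longrightarrow> Re (\<phi> (op_power T n u)) \<ge> 1/2"
    "\<And>n. cmod (\<phi> (op_power T n X)) \<le> e" "\<And>n. cmod (F (op_power T n u)) \<le> e"
proof -
  obtain m where m: "norm (op_power T m X) < e / 2"
  proof -
    have "\<forall>\<^sub>F n in sequentially. norm (op_power T n X) < e / 2"
      using tendsto_norm[OF power_tendsto_0[OF X]] e by (intro order_tendstoD) auto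
    then show thesis
      using that by (auto simp: eventually_sequentially)
  qed
  obtain \<zeta> :: "'a \<Rightarrow>\<^sub>L complex" where \<zeta>: "norm (F - (F o\<^sub>L proj) - (\<zeta> o\<^sub>L A)) < e / 2"
    using dual_ergodic[OF F, of "e / 2"] e by auto
  \<comment> \<open>The first bound limits the \<open>\<zeta>\<close> part of \<open>F\<close> to
    \<open>e / 2\<close>. The second keeps \<open>u\<close> within 1/4 of its orbit up to time
    \<open>N + m\<close>, which a functional of norm at most 2 sees as at most 1/2.\<close>
  define \<delta> where "\<delta> = min (e / (2 * (norm \<zeta> + 1))) (1 / (4 * (real (N + m) + 1)))"
  have "\<delta> > 0"
    using e by (simp add: \<delta>_def add_nonneg_pos)
  have \<delta>: "norm \<zeta> * \<delta> \<le> e / 2" "real (N + m) * \<delta> \<le> 1 / 4"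
  proof -
    have "norm \<zeta> * \<delta> \<le> norm \<zeta> * (e / (2 * (norm \<zeta> + 1)))"
      by (intro mult_left_mono) (simp_all add: \<delta>_def)
    also have "\<dots> \<le> (norm \<zeta> + 1) * (e / (2 * (norm \<zeta> + 1)))"
      using e by (intro mult_right_mono) auto
    also have "\<dots> = e / 2"
      by (simp add: field_simps add_nonneg_eq_0_iff)
    finally show "norm \<zeta> * \<delta> \<le> e / 2" .
    have "real (N + m) * \<delta> \<le> real (N + m) * (1 / (4 * (real (N + m) + 1)))"
      by (intro mult_left_mono) (simp_all add: \<delta>_def)
    also have "\<dots> \<le> (real (N + m) + 1) * (1 / (4 * (real (N + m) + 1)))"
      by (intro mult_right_mono) auto
    also have "\<dots> = 1 / 4"
      by (simp add: field_simps)
    finally show "real (N + m) * \<delta> \<le> 1 / 4" .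
  qed
  obtain u where u: "u \<in> Z" "norm u = 1" "norm (A u) < \<delta>"
    using approximate_eigenvector[OF A \<open>\<delta> > 0\<close>] .
  obtain \<psi> where \<psi>: "\<psi> \<in> cdual" "norm \<psi> \<le> 2" "Re (blinfun_apply \<psi> u) = 1"
    using norming_functional[of u] u(2) by metis
  have \<psi>_le: "cmod (\<psi> x) \<le> 2 * norm x" for x
    using norm_blinfun[of \<psi> x] mult_right_mono[OF \<psi>(2) norm_ge_zero[of x]] by simp
  let ?\<phi> = "\<psi> o\<^sub>L op_power T m"
  show thesis
  proof
    show "u \<in> Z" "norm u = 1"
      by fact+
    show "?\<phi> \<in> cdual"
      by (intro cbounded_ops_compose \<psi> op_power_mem_cbounded_ops T_cbounded)
    show "norm ?\<phi> \<le> 2"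
    proof (rule norm_blinfun_bound)
      show "cmod (?\<phi> x) \<le> 2 * norm x" for x
        using \<psi>_le[of "op_power T m x"] norm_power_le[of m x] by simp
    qed simp
  next
    fix n assume "n \<le> N"
    let ?w = "op_power T (m + n) u - u"
    have "norm ?w \<le> real (m + n) * norm (A u)"
      by (rule norm_power_diff_le)
    also have "\<dots> \<le> real (N + m) * \<delta>"
      using \<open>n \<le> N\<close> u(3) by (intro mult_mono) auto
    finally have "cmod (\<psi> ?w) \<le> 1 / 2"
      using \<psi>_le[of ?w] \<delta>(2) by simp
    then have "- (1 / 2) \<le> Re (\<psi> ?w)"
      using abs_Re_le_cmod[of "\<psi> ?w"] by linarith
    then show "Re (?\<phi> (op_power T n u)) \<ge> 1 / 2"
      using \<psi>(3) by (simp add: op_power_add_apply blinfun.diff_right)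
  next
    fix n
    have "cmod (\<psi> (op_power T n (op_power T m X))) \<le> 2 * norm (op_power T m X)"
      using \<psi>_le[of "op_power T n (op_power T m X)"] norm_power_le[of n "op_power T m X"] by simp
    then show "cmod (?\<phi> (op_power T n X)) \<le> e"
      using m by (simp add: add.commute flip: op_power_add_apply)
  next
    fix n
    \<comment> \<open>Orbits in \<open>Z\<close> are invisible to \<open>F o\<^sub>L proj\<close>,
      which leaves only the part approximated by \<open>\<zeta> o\<^sub>L A\<close>.\<close>
    have "proj (op_power T n u) = 0"
      by (intro proj_Z power_mem_Z u)
    then have "F (op_power T n u) = (F - (F o\<^sub>L proj) - (\<zeta> o\<^sub>L A)) (op_power T n u) + \<zeta> (A (op_power T n u))"
      by (simp add: blinfun.diff_left blinfun.zero_right)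
    also have "cmod \<dots> \<le> norm (F - (F o\<^sub>L proj) - (\<zeta> o\<^sub>L A)) * norm (op_power T n u)
        + norm \<zeta> * norm (op_power T n (A u))"
      unfolding power_A_commute[symmetric]
      by (intro order_trans[OF norm_triangle_ineq] add_mono norm_blinfun)
    also have "\<dots> \<le> e / 2 * 1 + norm \<zeta> * \<delta>"
      using \<zeta> norm_power_le[of n u] norm_power_le[of n "A u"] u e
      by (intro add_mono mult_mono) auto
    finally show "cmod (F (op_power T n u)) \<le> e"
      using \<delta>(1) by simp
  qed
qed

text \<open>Adding \<open>\<kappa>\<close> times the new pair creates a diagonal term and two cross
  terms, each of modulus at most \<open>\<kappa>\<^sup>2 / 8\<close> by the choice of tolerance. The
  diagonal is at least \<open>\<kappa>\<^sup>2 / 2\<close> up to \<open>N\<close> and never below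
  \<open>- 2 * \<kappa>\<^sup>2\<close>; hence the gain 1/4 and the loss 3, rounded up from
  9/4.\<close>

lemma slow_step:
  fixes F :: "'a \<Rightarrow>\<^sub>L complex"
  assumes A: "\<not> bounded_below" and X: "X \<in> Z" and F: "F \<in> cdual" and k: "\<kappa> > 0"
  defines "g \<equiv> \<lambda>(F :: 'a \<Rightarrow>\<^sub>L complex) X n. Re (F (op_power T n X))"
  obtains X' F' where "X' \<in> Z" "F' \<in> cdual" "norm (X' - X) \<le> \<kappa>" "norm (F' - F) \<le> 2 * \<kappa>"
    "\<And>n. g F' X' n \<ge> g F X n - 3 * \<kappa>\<^sup>2"
    "\<And>n. n \<le> N \<Longrightarrow> g F' X' n \<ge> g F X n + \<kappa>\<^sup>2 / 4"
proof -
  obtain u and \<phi> :: "'a \<Rightarrow>\<^sub>L complex" where u: "u \<in> Z" "norm u = 1" "\<phi> \<in> cdual" "norm \<phi> \<le> 2"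
    and diag: "\<And>n. n \<le> N \<Longrightarrow> Re (\<phi> (op_power T n u)) \<ge> 1/2"
    and off: "\<And>n. cmod (\<phi> (op_power T n X)) \<le> \<kappa> / 8" "\<And>n. cmod (F (op_power T n u)) \<le> \<kappa> / 8"
    using slow_pair[OF A X F, of "\<kappa> / 8" N] k by auto
  let ?X = "X + \<kappa> *\<^sub>R u" and ?F = "F + \<kappa> *\<^sub>R \<phi>"
  have g: "g ?F ?X n = g F X n + \<kappa>\<^sup>2 * Re (\<phi> (op_power T n u))
      + \<kappa> * Re (F (op_power T n u)) + \<kappa> * Re (\<phi> (op_power T n X))" for n
    by (simp add: g_def blinfun.add_left blinfun.add_right blinfun.scaleR_left blinfun.scaleR_right
        power2_eq_square algebra_simps)
  have off': "\<kappa> * Re c \<ge> - \<kappa>\<^sup>2 / 8" if "cmod c \<le> \<kappa> / 8" for c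
  proof -
    have "- (\<kappa> / 8) \<le> Re c"
      using abs_Re_le_cmod[of c] that by linarith
    then have "\<kappa> * (- (\<kappa> / 8)) \<le> \<kappa> * Re c"
      using k by (intro mult_left_mono) auto
    then show ?thesis
      by (simp add: power2_eq_square)
  qed
  have lower: "g ?F ?X n \<ge> g F X n + \<kappa>\<^sup>2 * Re (\<phi> (op_power T n u)) - \<kappa>\<^sup>2 / 4" for n
    using off'[OF off(1), of n] off'[OF off(2), of n] unfolding g by simp
  have "cmod (\<phi> (op_power T n u)) \<le> 2 * 1" for n
    using norm_power_le[of n u] u by (intro order_trans[OF norm_blinfun[of \<phi>]] mult_mono) auto
  then have diag': "Re (\<phi> (op_power T n u)) \<ge> - 2" for n
    using abs_Re_le_cmod[of "\<phi> (op_power T n u)"] by (smt (verit))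
  show thesis
  proof (rule that)
    show "?X \<in> Z"
      by (intro Z_add X Z_scaleR u)
    show "?F \<in> cdual"
      by (intro cbounded_ops_add F cbounded_ops_scaleR u)
    show "norm (?X - X) \<le> \<kappa>" "norm (?F - F) \<le> 2 * \<kappa>"
      using u k by (simp_all add: mult.commute)
    show "g F X n - 3 * \<kappa>\<^sup>2 \<le> g ?F ?X n" for n
      using mult_left_mono[OF diag'[of n] zero_le_power2[of \<kappa>]] lower[of n] zero_le_power2[of \<kappa>] by linarith
    show "g F X n + \<kappa>\<^sup>2 / 4 \<le> g ?F ?X n" if "n \<le> N" for n
      using mult_left_mono[OF diag[OF that] zero_le_power2[of \<kappa>]] lower[of n] by simp
  qed
qed

text \<open>
  At time \<open>n\<close> between \<open>N k\<close> and \<open>N (k + 1)\<close> the first \<open>k\<close> pairs have died out, the pair \<open>k\<close> may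
  contribute as little as \<open>- 3 q\<^sup>k\<close>, and every later pair \<open>l\<close> contributes at least \<open>q\<^sup>l / 4\<close>. Their
  total wins because \<open>q\<close> is close to 1.
\<close>

lemma slow_vector:
  assumes A: "\<not> bounded_below" and r: "\<And>n. r n \<le> 1" "r \<longlonglongrightarrow> (0::real)"
  obtains x and \<phi> :: "'a \<Rightarrow>\<^sub>L complex" where "x \<in> Z" "\<phi> \<in> cdual" "\<And>n. r n \<le> Re (\<phi> (op_power T n x))"
proof -
  \<comment> \<open>Vector and functional move by multiples of the powers of \<open>a\<close>, the
    pairing by multiples of those of \<open>q\<close>; the value is chosen to meet
    \<open>20 * (1 - q) \<le> q\<close>.\<close>
  define a :: real where "a = 99/100"
  define q where "q = a\<^sup>2"
  define g where "g F X n = Re (blinfun_apply F (op_power T n X))" for F :: "'a \<Rightarrow>\<^sub>L complex" and X n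
  have q: "0 < q" "q < 1" "20 * (1 - q) \<le> q"
    by (simp_all add: q_def a_def power2_eq_square)
  have aq: "(a ^ l)\<^sup>2 = q ^ l" for l
    by (simp add: q_def mult.commute flip: power_mult)
  \<comment> \<open>\<open>N\<close> is a time after which both \<open>r\<close> and the pairing
    built so far are below \<open>q ^ l\<close>. Starting at \<open>N = 0\<close>, where
    \<open>r\<close> is at most 1, covers every time.\<close>
  define P where "P l = (\<lambda>(X, F, N). X \<in> Z \<and> F \<in> cdual \<and> (l = 0 \<longrightarrow> N = 0) \<and>
      (\<forall>n\<ge>N. r n \<le> q ^ l \<and> \<bar>g F X n\<bar> \<le> q ^ l))"
    for l :: nat
  define Q where "Q l = (\<lambda>(X, F, N :: nat) (X', F', N').
      N < N' \<and> norm (X' - X) \<le> 1 * a ^ l \<and> norm (F' - F) \<le> 2 * a ^ l \<and>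
      (\<forall>n. g F' X' n \<ge> g F X n - 3 * q ^ l) \<and> (\<forall>n\<le>N. g F' X' n \<ge> g F X n + q ^ l / 4))"
    for l :: nat
  have start: "\<exists>s. P 0 s"
    using r(1) by (intro exI[of _ "(0, 0, 0)"]) (auto simp: P_def Z_0 g_def blinfun.zero_left)
  have step: "\<exists>s'. P (Suc l) s' \<and> Q l s s'" if "P l s" for s l
  proof -
    obtain X F N where s: "s = (X, F, N)"
      by (cases s)
    have XF: "X \<in> Z" "F \<in> cdual"
      using that by (auto simp: P_def s)
    obtain X' F' where X': "X' \<in> Z" and F': "F' \<in> cdual"
      and diff: "norm (X' - X) \<le> a ^ l" "norm (F' - F) \<le> 2 * a ^ l"
      and g1: "\<And>n. g F' X' n \<ge> g F X n - 3 * q ^ l"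
      and g2: "\<And>n. n \<le> N \<Longrightarrow> g F' X' n \<ge> g F X n + q ^ l / 4"
      using slow_step[OF A XF, of "a ^ l" N] unfolding g_def aq by (auto simp: a_def)
    have "(\<lambda>n. \<bar>g F' X' n\<bar>) \<longlonglongrightarrow> \<bar>Re (F' 0)\<bar>"
      unfolding g_def by (intro tendsto_intros power_tendsto_0 X')
    then have "\<forall>\<^sub>F n in sequentially. \<bar>g F' X' n\<bar> < q ^ Suc l"
      using q by (intro order_tendstoD) (auto simp: blinfun.zero_right)
    moreover have "\<forall>\<^sub>F n in sequentially. r n < q ^ Suc l"
      using q r(2) by (intro order_tendstoD) auto
    ultimately have "\<forall>\<^sub>F n in sequentially. r n \<le> q ^ Suc l \<and> \<bar>g F' X' n\<bar> \<le> q ^ Suc l"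
      by eventually_elim auto
    then obtain N' where N': "\<And>n. n \<ge> N' \<Longrightarrow> r n \<le> q ^ Suc l \<and> \<bar>g F' X' n\<bar> \<le> q ^ Suc l"
      by (auto simp: eventually_sequentially)
    show ?thesis
      using X' F' diff g1 g2 N'
      by (intro exI[of _ "(X', F', max (Suc N) N')"]) (auto simp: P_def Q_def s)
  qed
  obtain S where S: "\<And>l. P l (S l)" "\<And>l. Q l (S l) (S (Suc l))"
    using dependent_nat_choice[of P Q] start step by metis
  define X F N where "X l = fst (S l)" and "F l = fst (snd (S l))" and "N l = snd (snd (S l))" for l
  have XF: "X l \<in> Z" "F l \<in> cdual" and N: "\<And>n. n \<ge> N l \<Longrightarrow> r n \<le> q ^ l \<and> \<bar>g (F l) (X l) n\<bar> \<le> q ^ l"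
    and N_Suc: "N l < N (Suc l)"
    and diff: "norm (X (Suc l) - X l) \<le> 1 * a ^ l" "norm (F (Suc l) - F l) \<le> 2 * a ^ l"
    and g1: "\<And>n. g (F (Suc l)) (X (Suc l)) n \<ge> g (F l) (X l) n - 3 * q ^ l"
    and g2: "\<And>n. n \<le> N l \<Longrightarrow> g (F (Suc l)) (X (Suc l)) n \<ge> g (F l) (X l) n + q ^ l / 4" for l
    using S[of l] by (auto simp: P_def Q_def X_def F_def N_def case_prod_beta)
  obtain x where x: "X \<longlonglongrightarrow> x"
    using geometric_increments_converge[OF diff(1)] by (auto simp: a_def)
  obtain \<phi> where \<phi>: "F \<longlonglongrightarrow> \<phi>"
    using geometric_increments_converge[OF diff(2)] by (auto simp: a_def)
  have "N 0 = 0"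
    using S(1)[of 0] by (auto simp: P_def N_def case_prod_beta)
  have "strict_mono N"
    using N_Suc by (simp add: strict_mono_Suc_iff)
  have large: "r n \<le> Re (\<phi> (op_power T n x))" if "N k \<le> n" "n \<le> N (Suc k)" for k n
  proof -
    let ?g = "\<lambda>l. g (F l) (X l) n"
    \<comment> \<open>The old pairing and step k lose at most \<open>q ^ k\<close> and
      \<open>3 * q ^ k\<close>, giving the initial factor 1 - 5. A gain
      \<open>q ^ (Suc k + m) / 4\<close> pays for the passage from m to m + 1, worth
      \<open>5 * q ^ (k + m) * (1 - q)\<close>, exactly when
      \<open>20 * (1 - q) \<le> q\<close>.\<close>
    have lower: "?g (Suc k + m) \<ge> q ^ k * (1 - 5 * q ^ m)" for m
    proof (induction m)
      case 0
      then show ?case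
        using N[OF that(1)] g1[of k n] by (auto simp: abs_le_iff)
    next
      case (Suc m)
      have "n \<le> N (Suc k + m)"
        using that(2) strict_mono_leD[OF \<open>strict_mono N\<close>, of "Suc k" "Suc k + m"] by linarith
      then have "?g (Suc k + Suc m) \<ge> q ^ k * (1 - 5 * q ^ m) + q ^ (Suc k + m) / 4"
        using g2[of n "Suc k + m"] Suc.IH by simp
      moreover have "q ^ k * (1 - 5 * q ^ m) + q ^ (Suc k + m) / 4
          = q ^ k * (1 - 5 * q ^ Suc m) + q ^ (k + m) * ((q - 20 * (1 - q)) / 4)"
        by (simp add: power_add field_simps)
      moreover have "q ^ (k + m) * ((q - 20 * (1 - q)) / 4) \<ge> 0"
        using q by simp
      ultimately show ?case by linarith
    qed
    have "(\<lambda>m. q ^ k * (1 - 5 * q ^ m)) \<longlonglongrightarrow> q ^ k * (1 - 5 * 0)"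
      using q by (intro tendsto_intros LIMSEQ_realpow_zero) auto
    moreover have "(\<lambda>m. ?g (Suc k + m)) \<longlonglongrightarrow> Re (\<phi> (op_power T n x))"
    proof -
      have "?g \<longlonglongrightarrow> Re (\<phi> (op_power T n x))"
        unfolding g_def by (intro tendsto_intros x \<phi>)
      then show ?thesis
        using LIMSEQ_ignore_initial_segment[of ?g _ "Suc k"] by (simp add: add.commute)
    qed
    ultimately have "q ^ k * (1 - 5 * 0) \<le> Re (\<phi> (op_power T n x))"
      using lower by (intro LIMSEQ_le[of "\<lambda>m. q ^ k * (1 - 5 * q ^ m)"]) auto
    then show ?thesis
      using N[OF that(1)] by simp
  qed
  show thesis
  proof
    show "x \<in> Z"
      using closed_sequentially[OF closed_closure XF(1) x] .
    show "\<phi> \<in> cdual"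
      using cbounded_ops_limit[OF XF(2) \<phi>] .
    fix n
    show "r n \<le> Re (\<phi> (op_power T n x))"
    proof -
      have "\<exists>k. n < N k"
        using seq_suble[OF \<open>strict_mono N\<close>, of "Suc n"] by (intro exI[of _ "Suc n"]) simp
      define k where "k = (LEAST k. n < N k)"
      have "n < N k"
        unfolding k_def using \<open>\<exists>k. n < N k\<close> by (rule LeastI_ex)
      with \<open>N 0 = 0\<close> have "k \<noteq> 0"
        by (metis not_less0)
      then obtain j where j: "k = Suc j"
        by (cases k) auto
      then have "N j \<le> n"
        using not_less_Least[of j "\<lambda>k. n < N k"] by (simp add: k_def not_less)
      then show ?thesis
        using large \<open>n < N k\<close> j by (metis less_imp_le)
    qed
  qed
qed

theorem weakly_arbitrarily_slow_convergence:
  assumes "\<not> bounded_below"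
  shows "weakly_arbitrarily_slow (\<lambda>n. op_power T n - proj)"
  unfolding weakly_arbitrarily_slow_def
proof (intro allI impI)
  fix r :: "nat \<Rightarrow> real"
  assume r: "\<forall>n. 0 \<le> r n" "r \<longlonglongrightarrow> 0"
  obtain R where R: "R > 0" "\<And>n. r n \<le> R"
    using convergent_imp_Bseq[OF convergentI[OF r(2)]] r(1) by (auto simp: Bseq_def)
  have "(\<lambda>n. r n / R) \<longlonglongrightarrow> 0 / R"
    using R by (intro tendsto_intros r) auto
  then obtain x and \<phi> :: "'a \<Rightarrow>\<^sub>L complex"
    where x: "x \<in> Z" "\<phi> \<in> cdual" "\<And>n. r n / R \<le> Re (\<phi> (op_power T n x))"
    using slow_vector[OF assms, of "\<lambda>n. r n / R"] R by auto
  have "r n \<le> Re ((R *\<^sub>R \<phi>) ((op_power T n - proj) x))" for n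
    using x(3)[of n] R by (simp add: power_diff_proj proj_Z[OF x(1)] blinfun.scaleR_left field_simps)
  then show "\<exists>x. \<exists>\<phi>\<in>cdual. \<forall>n. r n \<le> Re (blinfun_apply \<phi> (blinfun_apply (op_power T n - proj) x))"
    using cbounded_ops_scaleR[OF x(2)] by blast
qed

section \<open>Closed range and the exponential rate\<close>

lemma closed_range_if_bounded_below:
  assumes "bounded_below" shows "closed (op_ran A)"
proof -
  obtain c where c: "c > 0" "\<And>z. z \<in> Z \<Longrightarrow> norm z \<le> c * norm (A z)"
    using assms by (auto simp: bounded_below_def)
  have "y \<in> op_ran A" if "y \<in> closure (op_ran A)" for y
  proof -
    obtain s where s: "\<And>n. s n \<in> op_ran A" "s \<longlonglongrightarrow> y"
      using \<open>y \<in> closure (op_ran A)\<close> unfolding closure_sequential by blast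
    \<comment> \<open>Preimages are moved into \<open>Z\<close>, where the lower bound makes them a
      Cauchy sequence.\<close>
    have "\<exists>z\<in>Z. A z = s n" for n
    proof -
      obtain w where "s n = A w"
        using s(1) by (auto simp: op_ran_def)
      then have "A (w - proj w) = s n"
        by (simp add: A_apply blinfun.diff_right T_proj)
      then show ?thesis
        using diff_proj_mem_Z by blast
    qed
    then obtain z where z: "\<And>n. z n \<in> Z" "\<And>n. A (z n) = s n"
      by metis
    have "Cauchy z"
    proof (rule metric_CauchyI)
      fix e :: real assume "e > 0"
      then obtain M where M: "\<And>m n. m \<ge> M \<Longrightarrow> n \<ge> M \<Longrightarrow> dist (s m) (s n) < e / c"
        using metric_CauchyD[OF LIMSEQ_imp_Cauchy[OF s(2)], of "e / c"] c(1) by auto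
      have "dist (z m) (z n) < e" if "m \<ge> M" "n \<ge> M" for m n
      proof -
        have "dist (z m) (z n) \<le> c * dist (s m) (s n)"
          using c(2)[OF Z_diff[OF z(1)[of m] z(1)[of n]]] by (simp add: dist_norm blinfun.diff_right z(2))
        also have "\<dots> < e"
          using M[OF that] c(1) by (simp add: field_simps)
        finally show ?thesis .
      qed
      then show "\<exists>M. \<forall>m\<ge>M. \<forall>n\<ge>M. dist (z m) (z n) < e"
        by blast
    qed
    then obtain w where w: "z \<longlonglongrightarrow> w"
      using Cauchy_convergent_iff convergent_def by blast
    have "(\<lambda>n. A (z n)) \<longlonglongrightarrow> A w"
      by (intro tendsto_intros w)
    then have "A w = y"
      using LIMSEQ_unique[OF s(2)] by (simp add: z(2))
    then show ?thesis
      by (auto simp: op_ran_def)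
  qed
  then show ?thesis
    using closure_subset_eq by blast
qed

text \<open>
  If \<open>A\<close> were not bounded below, some orbit would decay as slowly as \<open>\<surd>(d n)\<close>; but an orbit in the
  range of \<open>A\<close> decays like \<open>d n\<close>. This replaces the open mapping theorem.
\<close>

lemma bounded_below_if_closed_range:
  assumes "closed (op_ran A)" shows "bounded_below"
proof (rule ccontr)
  obtain K where K: "K > 0" "\<And>n. d n \<le> K / sqrt (real (Suc n))"
    using d_bound by blast
  \<comment> \<open>The explicit majorant stands in for \<open>d\<close>, which may vanish:
    \<open>sqrt (b n)\<close> is positive and can be cancelled.\<close>
  define b where "b n = K / sqrt (real (Suc n))" for n
  have b_pos: "b n > 0" for n
    using K(1) by (simp add: b_def)
  have "(\<lambda>n. K * sqrt (inverse (real (Suc n)))) \<longlonglongrightarrow> K * sqrt 0"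
    by (intro tendsto_intros LIMSEQ_inverse_real_of_nat)
  then have "b \<longlonglongrightarrow> 0"
    by (simp add: b_def[abs_def] real_sqrt_inverse divide_inverse del: of_nat_Suc)
  then have lim: "(\<lambda>n. sqrt (b n)) \<longlonglongrightarrow> 0"
    using tendsto_real_sqrt by fastforce
  assume "\<not> bounded_below"
  then have slow: "arbitrarily_slow (\<lambda>n. op_power T n - proj)"
    by (intro weakly_arbitrarily_slow_imp_arbitrarily_slow weakly_arbitrarily_slow_convergence)
  have "0 \<le> sqrt (b n)" for n
    using b_pos[of n] by simp
  then obtain x where x: "\<And>n. sqrt (b n) \<le> norm ((op_power T n - proj) x)"
    using slow[unfolded arbitrarily_slow_def, rule_format, of "\<lambda>n. sqrt (b n)"] lim by metis
  have "x - proj x \<in> op_ran A"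
    using diff_proj_mem_Z assms by simp
  then obtain w where w: "x - proj x = A w"
    by (auto simp: op_ran_def)
  have "1 \<le> sqrt (b n) * norm w" for n
  proof -
    have "sqrt (b n) \<le> norm (op_power T n (A w))"
      using x[of n] by (simp add: power_diff_proj w)
    also have "\<dots> \<le> b n * norm w"
      using K(2)[of n] by (intro order_trans[OF norm_power_A_le] mult_right_mono) (auto simp: b_def)
    also have "\<dots> = sqrt (b n) * (sqrt (b n) * norm w)"
      using b_pos[of n] by (simp flip: mult.assoc)
    finally show ?thesis
      using b_pos[of n] by (simp add: mult_le_cancel_left1)
  qed
  moreover have "(\<lambda>n. sqrt (b n) * norm w) \<longlonglongrightarrow> 0 * norm w"
    by (intro tendsto_intros lim)
  ultimately have "1 \<le> 0 * norm w"
    by (intro LIMSEQ_le_const[of _ _ 1]) auto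
  then show False by simp
qed

text \<open>The second factor maps into \<open>Z\<close>, where \<open>proj\<close> vanishes. This
  multiplicativity lets one norm below 1 force geometric decay.\<close>

lemma power_proj_compose:
  "op_power T (m + n) - proj = (op_power T m - proj) o\<^sub>L (op_power T n - proj)"
proof (rule blinfun_eqI)
  fix x
  have "proj (op_power T n (x - proj x)) = 0"
    by (intro proj_Z power_mem_Z diff_proj_mem_Z)
  then show "(op_power T (m + n) - proj) x = ((op_power T m - proj) o\<^sub>L (op_power T n - proj)) x"
    by (simp add: power_diff_proj op_power_add_apply)
qed

text \<open>Closed range provides a preimage of \<open>x - proj x\<close> under \<open>A\<close>,
  and the lower bound controls its size, so the decay of \<open>d\<close> becomes uniform.\<close>

lemma norm_power_proj_tendsto_0:
  assumes "bounded_below" shows "(\<lambda>n. norm (op_power T n - proj)) \<longlonglongrightarrow> 0"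
proof -
  obtain c where c: "c > 0" "\<And>z. z \<in> Z \<Longrightarrow> norm z \<le> c * norm (A z)"
    using assms by (auto simp: bounded_below_def)
  have bound: "norm (op_power T n - proj) \<le> 2 * c * d n" for n
  proof (rule norm_blinfun_bound)
    fix x
    have "x - proj x \<in> op_ran A"
      using diff_proj_mem_Z closed_range_if_bounded_below[OF assms] by simp
    then obtain v where v: "x - proj x = A v"
      by (auto simp: op_ran_def)
    define w where "w = v - proj v"
    have w: "x - proj x = A w" "w \<in> Z"
      using v diff_proj_mem_Z[of v] by (simp_all add: w_def A_apply blinfun.diff_right T_proj)
    have w_le: "norm w \<le> c * (2 * norm x)"
    proof -
      have "norm (x - proj x) \<le> 2 * norm x"
        using norm_triangle_ineq4[of x "proj x"] norm_proj_apply_le[of x] by simp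
      then show ?thesis
        using c(2)[OF w(2)] c(1) unfolding w(1) by (meson mult_left_mono less_imp_le order_trans)
    qed
    have "norm ((op_power T n - proj) x) \<le> d n * norm w"
      using norm_power_A_le[of n w] by (simp add: power_diff_proj w(1))
    also have "\<dots> \<le> d n * (c * (2 * norm x))"
      by (intro mult_left_mono w_le) auto
    finally show "norm ((op_power T n - proj) x) \<le> 2 * c * d n * norm x"
      by (simp add: mult_ac)
  qed (use c in simp)
  have "(\<lambda>n. 2 * c * d n) \<longlonglongrightarrow> 2 * c * 0"
    by (intro tendsto_intros d_tendsto_0)
  then show ?thesis
    using bound by (intro tendsto_sandwich[of "\<lambda>_. 0" "\<lambda>n. norm (op_power T n - proj)" _ "\<lambda>n. 2 * c * d n"]) auto
qed

lemma exponential_convergence: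
  assumes "bounded_below"
  obtains C \<rho> :: real where "C > 0" "0 \<le> \<rho>" "\<rho> < 1" "\<And>n. norm (op_power T n - proj) \<le> C * \<rho> ^ n"
proof -
  let ?D = "\<lambda>n. op_power T n - proj"
  have "\<forall>\<^sub>F n in sequentially. norm (?D n) < 1 / 2"
    using norm_power_proj_tendsto_0[OF assms] by (intro order_tendstoD) auto
  then obtain M where M: "\<And>n. n \<ge> M \<Longrightarrow> norm (?D n) < 1 / 2"
    by (auto simp: eventually_sequentially)
  define m where "m = Suc M"
  have m: "m > 0" "norm (?D m) \<le> 1 / 2"
    using M[of m] by (auto simp: m_def)
  define \<rho> where "\<rho> = root m (1 / 2)"
  have \<rho>: "0 < \<rho>" "\<rho> < 1" "\<rho> ^ m = 1 / 2"
    using m by (simp_all add: \<rho>_def real_root_lt_1_iff)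
  have D_le: "norm (?D n) \<le> 2" for n
  proof (rule norm_blinfun_bound)
    show "norm (?D n x) \<le> 2 * norm x" for x
      using norm_triangle_ineq4[of "op_power T n x" "proj x"] norm_power_le[of n x] norm_proj_apply_le[of x]
      by (simp add: blinfun.diff_left)
  qed simp
  have D_mult: "norm (?D (k * m + i)) \<le> (1 / 2) ^ k * 2" for k i
  proof (induction k)
    case (Suc k)
    have "norm (?D (Suc k * m + i)) \<le> norm (?D m) * norm (?D (k * m + i))"
      using norm_blinfun_compose[of "?D m" "?D (k * m + i)"]
      by (simp add: power_proj_compose[symmetric] add.assoc)
    also have "\<dots> \<le> (1 / 2) * ((1 / 2) ^ k * 2)"
      using m Suc.IH by (intro mult_mono) auto
    finally show ?case by simp
  qed (use D_le in simp)
  have "norm (?D n) \<le> 4 * \<rho> ^ n" for n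
  proof -
    have "norm (?D n) \<le> (\<rho> ^ m) ^ (n div m) * 2"
      using D_mult[of "n div m" "n mod m"] by (simp add: \<rho>(3))
    \<comment> \<open>One factor 2 bounds the incomplete block of \<open>n mod m\<close> steps; the
      other is \<open>1 / \<rho> ^ m\<close>, spent on replacing the exponent \<open>m\<close> by
      \<open>n mod m\<close>.\<close>
    also have "\<dots> = 4 * (\<rho> ^ (n div m * m) * \<rho> ^ m)"
      by (simp add: \<rho>(3) power_mult mult.commute[of _ m])
    also have "\<dots> \<le> 4 * (\<rho> ^ (n div m * m) * \<rho> ^ (n mod m))"
      using \<rho> m(1) by (intro mult_left_mono power_decreasing) (auto simp: less_imp_le)
    also have "\<dots> = 4 * \<rho> ^ n"
      by (simp flip: power_add)
    finally show ?thesis .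
  qed
  then show thesis
    using that[of 4 \<rho>] \<rho> by simp
qed

section \<open>Superpolynomial convergence on a dense subspace\<close>

text \<open>Each of the k factors \<open>A\<close> is matched with n of the \<open>k * n\<close>
  factors \<open>T\<close>.\<close>

lemma norm_power_range_power_le:
  "norm (op_power T (k * n) (op_power A k w)) \<le> d n ^ k * norm w"
proof (induction k)
  case (Suc k)
  have "op_power T (Suc k * n) (op_power A (Suc k) w) = op_power T n (A (op_power T (k * n) (op_power A k w)))"
    by (simp add: op_power_add_apply op_power_Suc power_A_commute)
  then have "norm (op_power T (Suc k * n) (op_power A (Suc k) w)) \<le> d n * norm (op_power T (k * n) (op_power A k w))"
    using norm_power_A_le by metis
  also have "\<dots> \<le> d n * (d n ^ k * norm w)"
    by (intro mult_left_mono Suc.IH) auto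
  finally show ?case by (simp add: mult.assoc)
qed simp

lemma superpolynomially_fast_if_range_powers:
  assumes range: "\<And>k. \<exists>w. x - proj x = op_power A k w"
  shows "superpolynomially_fast (\<lambda>n. op_power T n - proj) x"
  unfolding superpolynomially_fast_def
proof (intro allI impI)
  fix j :: nat
  let ?f = "\<lambda>n. norm ((op_power T n - proj) x)"
  \<comment> \<open>An even exponent removes the square root, and \<open>Suc j\<close> in place of
    \<open>j\<close> leaves a spare factor 1 / n that turns a bound into little-o.\<close>
  define k where "k = 2 * Suc j"
  obtain w where w: "x - proj x = op_power A k w"
    using range by blast
  obtain K where K: "K > 0" "\<And>n. d n \<le> K / sqrt (real (Suc n))"
    using d_bound by blast
  define M where "M = K ^ k * real k ^ Suc j * norm w"
  have bound: "?f n \<le> M / real n ^ Suc j" if "n > 0" for n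
  proof -
    let ?m = "n div k"
    have "k > 0"
      by (simp add: k_def)
    have "n = n mod k + k * ?m"
      by simp
    then have "?f n = norm (op_power T (n mod k) (op_power T (k * ?m) (op_power A k w)))"
      using op_power_add_apply[of T "n mod k" "k * ?m" "x - proj x"] by (simp add: power_diff_proj w)
    also have "\<dots> \<le> d ?m ^ k * norm w"
      using norm_power_le norm_power_range_power_le by (rule order_trans)
    also have "\<dots> \<le> (K / sqrt (real (Suc ?m))) ^ k * norm w"
      by (intro mult_right_mono power_mono K) auto
    also have "\<dots> = K ^ k / real (Suc ?m) ^ Suc j * norm w"
      unfolding k_def power_divide power_mult[of "sqrt _"] by simp
    also have "\<dots> \<le> K ^ k / (real n / real k) ^ Suc j * norm w"
    proof -
      have "real n \<le> real k * real (Suc ?m)"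
        using dividend_less_times_div[OF \<open>k > 0\<close>, of n]
        by (metis less_imp_le mult_Suc_right of_nat_le_iff of_nat_mult add.commute)
      then have "real n / real k \<le> real (Suc ?m)"
        using \<open>k > 0\<close> by (simp add: field_simps)
      then show ?thesis
        using \<open>k > 0\<close> \<open>n > 0\<close> K(1)
        by (intro mult_right_mono divide_left_mono power_mono mult_pos_pos zero_less_power) auto
    qed
    also have "\<dots> = M / real n ^ Suc j"
      by (simp add: M_def power_divide)
    finally show ?thesis .
  qed
  have "(\<lambda>n. ?f n / (1 / real n ^ j)) \<longlonglongrightarrow> 0"
  proof (rule tendsto_sandwich[of "\<lambda>_. 0" _ _ "\<lambda>n. M / real n"])
    have "?f n / (1 / real n ^ j) \<le> M / real n" if "n > 0" for n
      using mult_right_mono[OF bound[OF that], of "real n ^ j"] that by simp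
    then show "\<forall>\<^sub>F n in sequentially. ?f n / (1 / real n ^ j) \<le> M / real n"
      by (intro eventually_mono[OF eventually_gt_at_top[of 0]])
    show "(\<lambda>n. M / real n) \<longlonglongrightarrow> 0"
      by (rule lim_const_over_n)
  qed auto
  then show "?f \<in> o(\<lambda>n. 1 / real n ^ j)"
    by (intro smalloI_tendsto) (auto intro: eventually_mono[OF eventually_gt_at_top[of 0]])
qed

text \<open>The dense subspace is taken to consist of all such vectors, so Landau calculus suffices
  here.\<close>

lemma csubspace_superpolynomially_fast:
  "csubspace {x. superpolynomially_fast (\<lambda>n. op_power T n - proj) x}"
proof (rule csubspaceI)
  show "0 \<in> {x. superpolynomially_fast (\<lambda>n. op_power T n - proj) x}"
    by (simp add: superpolynomially_fast_def blinfun.zero_right)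
next
  fix x y
  let ?f = "\<lambda>x n. norm ((op_power T n - proj) x)"
  assume "x \<in> {x. superpolynomially_fast (\<lambda>n. op_power T n - proj) x}"
    "y \<in> {x. superpolynomially_fast (\<lambda>n. op_power T n - proj) x}"
  then have "(\<lambda>n. ?f x n + ?f y n) \<in> o(\<lambda>n. 1 / real n ^ k)" if "k \<ge> 1" for k
    using that by (auto simp: superpolynomially_fast_def intro: sum_in_smallo)
  moreover have "?f (x + y) \<in> O(\<lambda>n. ?f x n + ?f y n)"
    by (rule bigoI[of _ 1]) (simp add: blinfun.add_right norm_triangle_ineq)
  ultimately show "x + y \<in> {x. superpolynomially_fast (\<lambda>n. op_power T n - proj) x}"
    by (auto simp: superpolynomially_fast_def intro: landau_o.big_small_trans)
next
  fix c x
  let ?f = "\<lambda>x n. norm ((op_power T n - proj) x)"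
  assume "x \<in> {x. superpolynomially_fast (\<lambda>n. op_power T n - proj) x}"
  then have "?f x \<in> o(\<lambda>n. 1 / real n ^ k)" if "k \<ge> 1" for k
    using that by (simp add: superpolynomially_fast_def)
  moreover have "?f (c *\<^sub>C x) n = cmod c * ?f x n" for n
  proof -
    have "op_power T n - proj \<in> cbounded_ops"
      by (intro cbounded_ops_diff op_power_mem_cbounded_ops T_cbounded proj_cbounded)
    then show ?thesis
      by (simp add: cbounded_ops_iff norm_scaleC)
  qed
  then have "?f (c *\<^sub>C x) \<in> O(?f x)"
    by (intro bigoI[of _ "cmod c"]) simp
  ultimately show "c *\<^sub>C x \<in> {x. superpolynomially_fast (\<lambda>n. op_power T n - proj) x}"
    by (auto simp: superpolynomially_fast_def intro: landau_o.big_small_trans)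
qed

lemma norm_power_A_apply_le: "norm (op_power A k u) \<le> 2 ^ k * norm u"
proof (induction k)
  case (Suc k)
  have "norm (op_power A (Suc k) u) \<le> 2 * norm (op_power A k u)"
    by (simp add: op_power_Suc norm_A_le)
  with Suc show ?case by simp
qed simp

text \<open>
  A Mittag-Leffler argument: \<open>z\<close> is approximated by \<open>A z\<^sub>1\<close>, then \<open>z\<^sub>1\<close> by \<open>A z\<^sub>2\<close>, and so on,
  fast enough for \<open>A\<^sup>k z\<^sub>j\<^sub>+\<^sub>k\<close> to converge for every \<open>j\<close>.
\<close>

lemma range_powers_dense:
  assumes z: "z \<in> Z" and e: "e > 0"
  obtains y where "norm (y - z) \<le> 2 * e" "\<And>k. \<exists>w. y = op_power A k w"
proof -
  \<comment> \<open>The ratio 1/4 beats the factor \<open>2 ^ k\<close> lost in applying the k-th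
    power of \<open>A\<close>, leaving the summable \<open>(1/2) ^ k\<close>.\<close>
  have "\<exists>s. \<forall>k. (s k \<in> Z \<and> (k = 0 \<longrightarrow> s k = z)) \<and> norm (A (s (Suc k)) - s k) \<le> e * (1/4) ^ k"
  proof (rule dependent_nat_choice)
    fix u and k :: nat assume u: "u \<in> Z \<and> (k = 0 \<longrightarrow> u = z)"
    obtain w where "norm (u - A w) < e * (1/4) ^ k"
      using Z_approx[of u "e * (1/4) ^ k"] u e by auto
    \<comment> \<open>Removing the fixed component keeps the approximant in \<open>Z\<close>, so it
      can be approximated in turn.\<close>
    moreover have "A w = A (w - proj w)"
      by (simp add: A_apply blinfun.diff_right T_proj)
    ultimately show "\<exists>v. (v \<in> Z \<and> (Suc k = 0 \<longrightarrow> v = z)) \<and> norm (A v - u) \<le> e * (1/4) ^ k"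
      using diff_proj_mem_Z[of w] by (intro exI[of _ "w - proj w"]) (simp add: norm_minus_commute)
  qed (use z in auto)
  then obtain s where s: "s 0 = z" "\<And>k. norm (A (s (Suc k)) - s k) \<le> e * (1/4) ^ k"
    by blast
  have incr: "norm (op_power A (Suc k) (s (j + Suc k)) - op_power A k (s (j + k))) \<le> e * (1/2) ^ k" for j k
  proof -
    have "op_power A (Suc k) (s (j + Suc k)) - op_power A k (s (j + k))
        = op_power A k (A (s (Suc (j + k))) - s (j + k))"
      by (simp add: op_power_Suc op_power_commute blinfun.diff_right)
    then have "norm (op_power A (Suc k) (s (j + Suc k)) - op_power A k (s (j + k)))
        \<le> 2 ^ k * norm (A (s (Suc (j + k))) - s (j + k))"
      using norm_power_A_apply_le by metis
    also have "\<dots> \<le> 2 ^ k * (e * (1/4) ^ (j + k))"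
      by (intro mult_left_mono s) auto
    also have "\<dots> \<le> 2 ^ k * (e * (1/4) ^ k)"
      using e by (intro mult_left_mono power_decreasing) auto
    also have "\<dots> = e * (2 * (1/4)) ^ k"
      by (simp only: power_mult_distrib mult_ac)
    finally show ?thesis by simp
  qed
  have "\<exists>y. (\<lambda>k. op_power A k (s (j + k))) \<longlonglongrightarrow> y \<and> norm (y - s j) \<le> 2 * e" for j
  proof -
    obtain y where "(\<lambda>k. op_power A k (s (j + k))) \<longlonglongrightarrow> y"
      "norm (y - op_power A 0 (s (j + 0))) \<le> e / (1 - 1/2)"
      by (rule geometric_increments_converge[OF incr]) auto
    then show ?thesis
      by (intro exI[of _ y]) (simp add: mult.commute)
  qed
  then obtain y where y: "\<And>j. (\<lambda>k. op_power A k (s (j + k))) \<longlonglongrightarrow> y j" "\<And>j. norm (y j - s j) \<le> 2 * e"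
    by metis
  \<comment> \<open>Applying \<open>A\<close> to the sequence for \<open>Suc j\<close> gives the
    sequence for \<open>j\<close> shifted by one.\<close>
  have A_y: "A (y (Suc j)) = y j" for j
  proof (rule LIMSEQ_unique)
    show "(\<lambda>k. A (op_power A k (s (Suc j + k)))) \<longlonglongrightarrow> A (y (Suc j))"
      by (intro tendsto_intros y)
    show "(\<lambda>k. A (op_power A k (s (Suc j + k)))) \<longlonglongrightarrow> y j"
      using LIMSEQ_Suc[OF y(1)[of j]] by (simp add: op_power_Suc)
  qed
  have "y 0 = op_power A k (y k)" for k
  proof (induction k)
    case (Suc k)
    then show ?case
      by (simp add: op_power_Suc op_power_commute A_y)
  qed simp
  then show thesis
    using that[of "y 0"] y(2)[of 0] s(1) by auto
qed

text \<open>The fixed component is kept and only the component in \<open>Z\<close> is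
  approximated.\<close>

lemma superpolynomially_fast_dense:
  "closure {x. superpolynomially_fast (\<lambda>n. op_power T n - proj) x} = UNIV"
proof -
  have "\<exists>x'. superpolynomially_fast (\<lambda>n. op_power T n - proj) x' \<and> dist x' x < e" if e: "e > 0" for x e
  proof -
    obtain y where y: "norm (y - (x - proj x)) \<le> 2 * (e / 3)" "\<And>k. \<exists>w. y = op_power A k w"
      using range_powers_dense[OF diff_proj_mem_Z[of x], of "e / 3"] e by auto
    have "y \<in> Z"
      using y(2)[of 1] A_mem_Z by (auto simp: op_power_Suc)
    then have "proj (proj x + y) = proj x"
      by (intro proj_eqI) (simp_all add: T_proj)
    then have "superpolynomially_fast (\<lambda>n. op_power T n - proj) (proj x + y)"
      using y(2) by (intro superpolynomially_fast_if_range_powers) simp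
    moreover have "dist (proj x + y) x < e"
      using y(1) e by (simp add: dist_norm algebra_simps)
    ultimately show ?thesis by blast
  qed
  then show ?thesis
    by (auto simp: closure_approachable)
qed

end

theorem theorem5p1:
  fixes P :: "nat \<Rightarrow> 'a::cbanach \<Rightarrow>\<^sub>L 'a"
    and N :: nat
    and T :: "'a \<Rightarrow>\<^sub>L 'a"
    and Z :: "'a set"
  assumes refl: "reflexive_space TYPE('a)"
    and typeU: "\<And>k. k \<in> {1..N} \<Longrightarrow> type_U_projection (P k)"
    and T_op: "T \<in> cbounded_ops"
    and T_conv: "T \<in> convex hull (op_products {T_pair P k l |k l. k \<in> {1..N} \<and> l \<in> {1..N}})"
    and Z: "Z = closure (op_ran (id_blinfun - T))"
  shows "is_direct_sum (op_fix T) Z \<and>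
    (\<exists>P\<^sub>T. projection_onto_along P\<^sub>T (op_fix T) Z \<and>
       orthoprojection P\<^sub>T \<and>
       (\<forall>x. (\<lambda>n. norm (blinfun_apply (op_power T n) x - blinfun_apply P\<^sub>T x)) \<longlonglongrightarrow> 0) \<and>
       (closed (op_ran (id_blinfun - T)) \<longrightarrow>
          (\<exists>C r::real. C > 0 \<and> 0 \<le> r \<and> r < 1 \<and>
             (\<forall>n. norm (op_power T n - P\<^sub>T) \<le> C * r ^ n))) \<and>
       (\<not> closed (op_ran (id_blinfun - T)) \<longrightarrow>
          arbitrarily_slow (\<lambda>n. op_power T n - P\<^sub>T) \<and>
          weakly_arbitrarily_slow (\<lambda>n. op_power T n - P\<^sub>T)) \<and>
       (\<exists>X\<^sub>0. csubspace X\<^sub>0 \<and> closure X\<^sub>0 = UNIV \<and>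
          (\<forall>x\<in>X\<^sub>0. superpolynomially_fast (\<lambda>n. op_power T n - P\<^sub>T) x)))"
proof -
  have "{T_pair P k l |k l. k \<in> {1..N} \<and> l \<in> {1..N}} \<subseteq> averaged_ops"
    using typeU by (auto intro!: T_pair_mem_averaged_ops)
  then have "convex hull (op_products {T_pair P k l |k l. k \<in> {1..N} \<and> l \<in> {1..N}}) \<subseteq> averaged_ops"
    by (intro hull_minimal op_products_subset_averaged_ops convex_averaged_ops)
  with T_conv have "T \<in> averaged_ops"
    by (rule set_mp[rotated])
  then interpret averaged_operator T
    by (rule averaged_operator.intro[OF refl T_op])
  show ?thesis
    unfolding Z
  proof (intro conjI exI[of _ proj] allI impI)
    show "is_direct_sum (op_fix T) (closure (op_ran (id_blinfun - T)))"
      by (rule is_direct_sum_fix_Z)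
    show "projection_onto_along proj (op_fix T) (closure (op_ran (id_blinfun - T)))"
      by (rule projection_onto_along_proj)
    show "orthoprojection proj"
      by (rule orthoprojection_proj)
    show "(\<lambda>n. norm (blinfun_apply (op_power T n) x - blinfun_apply proj x)) \<longlonglongrightarrow> 0" for x
      by (intro tendsto_norm_zero LIM_zero power_tendsto_proj)
    show "\<exists>C r. C > 0 \<and> 0 \<le> r \<and> r < 1 \<and> (\<forall>n. norm (op_power T n - proj) \<le> C * r ^ n)"
      if "closed (op_ran (id_blinfun - T))"
      using exponential_convergence[OF bounded_below_if_closed_range[OF that]] by metis
    show slow: "weakly_arbitrarily_slow (\<lambda>n. op_power T n - proj)"
      if "\<not> closed (op_ran (id_blinfun - T))"
      using that closed_range_if_bounded_below weakly_arbitrarily_slow_convergence by blast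
    show "arbitrarily_slow (\<lambda>n. op_power T n - proj)" if "\<not> closed (op_ran (id_blinfun - T))"
      using slow[OF that] by (rule weakly_arbitrarily_slow_imp_arbitrarily_slow)
    show "\<exists>X\<^sub>0. csubspace X\<^sub>0 \<and> closure X\<^sub>0 = UNIV \<and>
        (\<forall>x\<in>X\<^sub>0. superpolynomially_fast (\<lambda>n. op_power T n - proj) x)"
      using csubspace_superpolynomially_fast superpolynomially_fast_dense by blast
  qed
qed

end
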